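(* Let $\mathbb{F}_q$ be a finite field of characteristic $p$, let $f \in \mathbb{F}_q[x_1,\dots,x_n]$ be a polynomial of total degree $d$ in $n$ variables, and let $X$ be the affine hypersurface over $\mathbb{F}_q$ defined by $f=0$ in affine $n$-space. Let $R(d)$ be the $\mathbb{F}_q$-vector space spanned by the monomials in $x_1,\dots,x_n$ that have total degree at most $d$ and are divisible by $x_1\cdots x_n$. The $\mathbb{F}_q$-linear operator $\psi_q\circ f^{q-1}$ maps $R(d)$ to itself, and $$Z(X,T)^{(-1)^n} \equiv \det\bigl(I - (\psi_q\circ f^{q-1})\,T \,\big|\, R(d)\bigr) \pmod p .$$
   Context: The zeta function of a variety $X/\mathbb{F}_q$ is $Z(X,T)=\exp\bigl(\sum_{k\ge 1} \frac{N_k(X)}{k}T^k\bigr)$, where $N_k(X)$ is the number of $\mathbb{F}_{q^k}$-rational points of $X$; it is a power series in $1+T\mathbb{Z}[[T]]$. The operator $\psi_q$ on $\mathbb{F}_q[x_1,\dots,x_n]$ is the $\mathbb{F}_q$-linear map with $\psi_q(x_1^{u_1}\cdots x_n^{u_n}) = x_1^{u_1/q}\cdots x_n^{u_n/q}$ if $q$ divides every $u_i$, and $0$ otherwise. The symbol $f^{q-1}$ also denotes the operator of multiplication by the polynomial $f^{q-1}$, so $(\psi_q\circ f^{q-1})(h)=\psi_q(f^{q-1}h)$. The congruence modulo $p$ means that the reduction of the left side in $\mathbb{F}_p[[T]]\subset\mathbb{F}_q[[T]]$ equals the right side. The determinant on the zero vector space is $1$. *)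

theory Defs
  imports
    "HOL-Library.Cardinality"
    "HOL-Library.Poly_Mapping"
    "HOL-Algebra.Algebraic_Closure_Type"
    "Jordan_Normal_Form.Determinant"
begin

section \<open>The determinant of an operator on a finite-dimensional space\<close>

definition ordered_basis :: "('a::field \<Rightarrow> 'b::ab_group_add \<Rightarrow> 'b) \<Rightarrow> 'b set \<Rightarrow> 'b list \<Rightarrow> bool" where
  "ordered_basis scale V bs \<longleftrightarrow>
     distinct bs \<and> \<not> module.dependent scale (set bs) \<and> module.span scale (set bs) = V"

definition op_mat :: "('a::field \<Rightarrow> 'b::ab_group_add \<Rightarrow> 'b) \<Rightarrow> ('b \<Rightarrow> 'b) \<Rightarrow> 'b list \<Rightarrow> 'a mat" where
  "op_mat scale \<phi> bs = mat (length bs) (length bs)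
     (\<lambda>(i, j). module.representation scale (set bs) (\<phi> (bs ! j)) (bs ! i))"

definition I_minus_T :: "'a::field mat \<Rightarrow> 'a poly mat" where
  "I_minus_T A = 1\<^sub>m (dim_row A) - [:0, 1:] \<cdot>\<^sub>m map_mat (\<lambda>c. [:c:]) A"

text \<open>
  \<open>det (I - \<phi> T | V)\<close> as a polynomial in \<open>T\<close>. It does not depend on the chosen basis,
  see \<open>det_I_minus_eq\<close> below.
\<close>
definition det_I_minus ::
    "('a::field \<Rightarrow> 'b::ab_group_add \<Rightarrow> 'b) \<Rightarrow> ('b \<Rightarrow> 'b) \<Rightarrow> 'b set \<Rightarrow> 'a poly" where
  "det_I_minus scale \<phi> V =
     Determinant.det (I_minus_T (op_mat scale \<phi> (SOME bs. ordered_basis scale V bs)))"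

lemma det_I_minus_T_basis:
  fixes scale :: "'a::field \<Rightarrow> 'b::ab_group_add \<Rightarrow> 'b" (infixr "*s" 75)
  assumes vs: "vector_space scale"
    and lin: "Vector_Spaces.linear scale scale \<phi>" and inv: "\<phi> ` V \<subseteq> V"
    and b: "ordered_basis scale V bs" and c: "ordered_basis scale V cs"
  shows "Determinant.det (I_minus_T (op_mat scale \<phi> bs)) =
         Determinant.det (I_minus_T (op_mat scale \<phi> cs))"
proof -
  interpret vs: vector_space scale by (fact vs)
  have hom: "module_hom scale scale \<phi>"
    using lin by (simp add: module_hom_iff_linear)
  have lens: "length bs = length cs"
    using b c vs.bij_if_span_eq_span_bases[of "set bs" "set cs"]
    by (metis bij_betw_same_card distinct_card ordered_basis_def)
  define n where "n = length bs"
  define P where "P xs ys = mat n n (\<lambda>(i, j). vs.representation (set xs) (ys ! j) (xs ! i))"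
    for xs ys :: "'b list"
  define L where "L = map_mat (\<lambda>c::'a. [:c:])"
  have rep: "v = (\<Sum>i<n. vs.representation (set xs) v (xs ! i) *s xs ! i)"
    if x: "ordered_basis scale V xs" "length xs = n" and v: "v \<in> V" for xs v
  proof -
    have "(\<Sum>b\<in>set xs. vs.representation (set xs) v b *s b) = v"
      using x v by (intro vs.sum_representation_eq) (auto simp: ordered_basis_def)
    moreover have "(\<Sum>b\<in>set xs. vs.representation (set xs) v b *s b) =
        (\<Sum>i<n. vs.representation (set xs) v (xs ! i) *s xs ! i)"
      using x bij_betw_nth[of xs "{..<n}" "set xs"]
      by (intro sum.reindex_bij_betw[symmetric]) (auto simp: ordered_basis_def)
    ultimately show ?thesis by simp
  qed
  have mem: "xs ! i \<in> V" if "ordered_basis scale V xs" "i < length xs" for xs i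
    using that by (auto simp: ordered_basis_def intro: vs.span_base)
  have trans: "vs.representation (set xs) v x = (\<Sum>k<n. vs.representation (set xs) (ys ! k) x *
      vs.representation (set ys) v (ys ! k))"
    if x: "ordered_basis scale V xs" and y: "ordered_basis scale V ys" "length ys = n" and v: "v \<in> V"
    for xs ys v x
  proof -
    have "vs.representation (set xs) v x =
        vs.representation (set xs) (\<Sum>i<n. vs.representation (set ys) v (ys ! i) *s ys ! i) x"
      using rep[OF y v] by simp
    also have "\<dots> = (\<Sum>i<n. vs.representation (set xs) (vs.representation (set ys) v (ys ! i) *s ys ! i) x)"
      using x y mem[OF y(1)] by (subst vs.representation_sum) (auto simp: ordered_basis_def intro: vs.span_scale)
    also have "\<dots> = (\<Sum>k<n. vs.representation (set xs) (ys ! k) x * vs.representation (set ys) v (ys ! k))"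
      using x y mem[OF y(1)]
      by (intro sum.cong refl, subst vs.representation_scale) (auto simp: ordered_basis_def mult.commute)
    finally show ?thesis .
  qed
  have prod: "P xs ys * P ys xs = 1\<^sub>m n"
    if x: "ordered_basis scale V xs" "length xs = n" and y: "ordered_basis scale V ys" "length ys = n" for xs ys
  proof (rule eq_matI)
    fix i j assume ij: "i < dim_row (1\<^sub>m n :: 'a mat)" "j < dim_col (1\<^sub>m n :: 'a mat)"
    hence "(P xs ys * P ys xs) $$ (i, j) = (\<Sum>k<n. vs.representation (set xs) (ys ! k) (xs ! i) *
        vs.representation (set ys) (xs ! j) (ys ! k))"
      by (simp add: P_def scalar_prod_def lessThan_atLeast0)
    also have "\<dots> = vs.representation (set xs) (xs ! j) (xs ! i)"
      using trans[OF x(1) y mem[OF x(1)], of j "xs ! i"] ij x by simp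
    also have "\<dots> = 1\<^sub>m n $$ (i, j)"
      using ij x by (subst vs.representation_basis) (auto simp: ordered_basis_def nth_eq_iff_index_eq)
    finally show "(P xs ys * P ys xs) $$ (i, j) = 1\<^sub>m n $$ (i, j)" .
  qed (auto simp: P_def)
  have conj: "P cs bs * op_mat scale \<phi> bs = op_mat scale \<phi> cs * P cs bs"
  proof (rule eq_matI)
    fix i j assume "i < dim_row (op_mat scale \<phi> cs * P cs bs)" "j < dim_col (op_mat scale \<phi> cs * P cs bs)"
    hence ij: "i < n" "j < n" by (auto simp: op_mat_def P_def lens n_def)
    have bV: "bs ! j \<in> V" using mem[OF b] ij n_def by simp
    have cV: "\<And>k. k < n \<Longrightarrow> cs ! k \<in> V" using mem[OF c] lens n_def by simp
    have "(P cs bs * op_mat scale \<phi> bs) $$ (i, j) = (\<Sum>k<n. vs.representation (set cs) (bs ! k) (cs ! i) *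
        vs.representation (set bs) (\<phi> (bs ! j)) (bs ! k))"
      using ij by (simp add: P_def op_mat_def n_def scalar_prod_def lessThan_atLeast0)
    also have "\<dots> = vs.representation (set cs) (\<phi> (bs ! j)) (cs ! i)"
      using trans[OF c b, of "\<phi> (bs ! j)"] inv bV n_def by auto
    also have "\<phi> (bs ! j) = \<phi> (\<Sum>k<n. vs.representation (set cs) (bs ! j) (cs ! k) *s cs ! k)"
      using rep[OF c _ bV] lens n_def by simp
    also have "\<dots> = (\<Sum>k<n. vs.representation (set cs) (bs ! j) (cs ! k) *s \<phi> (cs ! k))"
      by (simp add: module_hom.sum[OF hom] module_hom.scale[OF hom])
    also have "vs.representation (set cs) \<dots> (cs ! i) =
        (\<Sum>k<n. vs.representation (set cs) (vs.representation (set cs) (bs ! j) (cs ! k) *s \<phi> (cs ! k)) (cs ! i))"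
      using c cV inv by (subst vs.representation_sum) (auto simp: ordered_basis_def intro!: vs.span_scale)
    also have "\<dots> = (\<Sum>k<n. vs.representation (set cs) (\<phi> (cs ! k)) (cs ! i) *
        vs.representation (set cs) (bs ! j) (cs ! k))"
      using c cV inv
      by (intro sum.cong refl, subst vs.representation_scale) (auto simp: ordered_basis_def mult.commute)
    also have "\<dots> = (op_mat scale \<phi> cs * P cs bs) $$ (i, j)"
      using ij lens by (simp add: P_def op_mat_def n_def scalar_prod_def lessThan_atLeast0)
    finally show "(P cs bs * op_mat scale \<phi> bs) $$ (i, j) = (op_mat scale \<phi> cs * P cs bs) $$ (i, j)" .
  qed (use lens in \<open>auto simp: P_def op_mat_def n_def\<close>)
  have carr [simp]: "P xs ys \<in> carrier_mat n n" "op_mat scale \<phi> bs \<in> carrier_mat n n"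
    "op_mat scale \<phi> cs \<in> carrier_mat n n" for xs ys
    using lens by (auto simp: P_def op_mat_def n_def)
  have Lcarr [simp]: "L A \<in> carrier_mat n n" if "A \<in> carrier_mat n n" for A
    using that by (simp add: L_def)
  interpret hom: semiring_hom "\<lambda>c::'a. [:c:]" by standard auto
  have Lmult: "L (A * B) = L A * L B" if "A \<in> carrier_mat n n" "B \<in> carrier_mat n n" for A B
    unfolding L_def using that by (rule hom.mat_hom_mult)
  have Lone: "L (1\<^sub>m n) = 1\<^sub>m n" unfolding L_def by (rule hom.mat_hom_one)
  have rcp: "I_minus_T A = 1\<^sub>m n - [:0, 1:] \<cdot>\<^sub>m L A" if "A \<in> carrier_mat n n" for A
    using that by (auto simp: I_minus_T_def L_def)
  have eq: "L (P cs bs) * I_minus_T (op_mat scale \<phi> bs) =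
            I_minus_T (op_mat scale \<phi> cs) * L (P cs bs)"
  proof -
    have "L (P cs bs) * I_minus_T (op_mat scale \<phi> bs) =
        L (P cs bs) - [:0, 1:] \<cdot>\<^sub>m (L (P cs bs) * L (op_mat scale \<phi> bs))"
      by (subst rcp, simp, subst mult_minus_distrib_mat[of _ n n _ n])
        (auto simp: mult_smult_distrib[of _ n n _ n] right_mult_one_mat[of _ n n])
    also have "L (P cs bs) * L (op_mat scale \<phi> bs) = L (op_mat scale \<phi> cs) * L (P cs bs)"
      by (simp add: Lmult[symmetric] conj)
    also have "L (P cs bs) - [:0, 1:] \<cdot>\<^sub>m (L (op_mat scale \<phi> cs) * L (P cs bs)) =
        I_minus_T (op_mat scale \<phi> cs) * L (P cs bs)"
      by (subst rcp, simp, subst minus_mult_distrib_mat[of _ n n _ _ n])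
        (auto simp: mult_smult_assoc_mat[of _ n n _ n] left_mult_one_mat[of _ n n])
    finally show ?thesis .
  qed
  have rcarr: "I_minus_T A \<in> carrier_mat n n" if "A \<in> carrier_mat n n" for A :: "'a mat"
    using that by (simp add: rcp minus_carrier_mat)
  have "Determinant.det (L (P cs bs)) * Determinant.det (I_minus_T (op_mat scale \<phi> bs)) =
        Determinant.det (I_minus_T (op_mat scale \<phi> cs)) * Determinant.det (L (P cs bs))"
    using arg_cong[OF eq, of Determinant.det]
    by (simp add: det_mult[of _ n] rcarr)
  moreover have "Determinant.det (L (P cs bs)) \<noteq> 0"
  proof -
    have "Determinant.det (L (P cs bs)) * Determinant.det (L (P bs cs)) = 1"
    proof -
      have "Determinant.det (L (P cs bs)) * Determinant.det (L (P bs cs)) =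
          Determinant.det (L (P cs bs * P bs cs))"
        by (simp add: det_mult[of _ n] Lmult)
      also have "P cs bs * P bs cs = 1\<^sub>m n"
        using prod[OF c _ b] lens by (simp add: n_def)
      finally show ?thesis by (simp add: Lone)
    qed
    thus ?thesis by auto
  qed
  ultimately show ?thesis by (simp add: mult.commute)
qed

lemma det_I_minus_eq:
  assumes "vector_space scale" "Vector_Spaces.linear scale scale \<phi>" "\<phi> ` V \<subseteq> V" "ordered_basis scale V bs"
  shows "det_I_minus scale \<phi> V = Determinant.det (I_minus_T (op_mat scale \<phi> bs))"
  unfolding det_I_minus_def
  using assms by (intro det_I_minus_T_basis[of scale \<phi> V]) (auto intro: someI)



section \<open>Polynomials over a field, with variables indexed by a finite type\<close>

text \<open>
  The index type \<open>'n\<close> is finite and nonempty, so there are \<open>CARD('n) \<ge> 1\<close> variables.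
  Monomials are given by their exponent vectors.
\<close>
type_synonym ('n, 'a) mpoly = "('n \<Rightarrow>\<^sub>0 nat) \<Rightarrow>\<^sub>0 'a"

definition mscale :: "'a \<Rightarrow> ('n, 'a::field) mpoly \<Rightarrow> ('n, 'a) mpoly" where
  "mscale c h = Poly_Mapping.map ((*) c) h"

lemma lookup_mscale [simp]: "Poly_Mapping.lookup (mscale c h) u = c * Poly_Mapping.lookup h u"
  by (simp add: mscale_def Poly_Mapping.map.rep_eq when_def)

interpretation mpoly: vector_space "mscale :: 'a \<Rightarrow> ('n, 'a::field) mpoly \<Rightarrow> ('n, 'a) mpoly"
  by standard (auto intro!: poly_mapping_eqI simp: lookup_add algebra_simps)

lemma mscale_eq_mult: "mscale c h = Poly_Mapping.single 0 c * (h :: ('n, 'a::field) mpoly)"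
proof (rule poly_mapping_eqI)
  fix k
  have "Poly_Mapping.lookup (Poly_Mapping.single 0 c * h) k =
      (\<Sum>l. (c when 0 = l) * (\<Sum>q. (Poly_Mapping.lookup h q when k = l + q)))"
    by (simp add: times_poly_mapping.rep_eq prod_fun_def lookup_single)
  also have "\<dots> = (\<Sum>l. c * (\<Sum>q. (Poly_Mapping.lookup h q when k = l + q)) when 0 = l)"
    by (intro Sum_any.cong) (auto simp: when_def)
  also have "\<dots> = c * Poly_Mapping.lookup h k"
    by simp
  finally show "Poly_Mapping.lookup (mscale c h) k =
      Poly_Mapping.lookup (Poly_Mapping.single 0 c * h) k"
    by simp
qed

definition mdegree :: "('n::finite \<Rightarrow>\<^sub>0 nat) \<Rightarrow> nat" where
  "mdegree u = (\<Sum>i\<in>UNIV. Poly_Mapping.lookup u i)"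

text \<open>The zero polynomial gets total degree \<open>0\<close>.\<close>
definition total_degree :: "('n::finite, 'a::zero) mpoly \<Rightarrow> nat" where
  "total_degree f = Max (insert 0 (mdegree ` Poly_Mapping.keys f))"

definition mpoly_var :: "'n \<Rightarrow> ('n, 'a::field) mpoly" where
  "mpoly_var i = Poly_Mapping.single (Poly_Mapping.single i 1) 1"

definition monomials :: "('n, 'a::field) mpoly set" where
  "monomials = range (\<lambda>u. Poly_Mapping.single u 1)"

definition R_monomials :: "nat \<Rightarrow> ('n::finite, 'a::field) mpoly set" where
  "R_monomials d = {m \<in> monomials. total_degree m \<le> d \<and> (\<Prod>i\<in>UNIV. mpoly_var i) dvd m}"

definition R_space :: "nat \<Rightarrow> ('n::finite, 'a::field) mpoly set" where
  "R_space d = mpoly.span (R_monomials d)"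

lemma R_monomials_iff:
  "Poly_Mapping.single u 1 \<in> (R_monomials d :: ('n::finite, 'a::field) mpoly set) \<longleftrightarrow>
     mdegree u \<le> d \<and> (\<forall>i. Poly_Mapping.lookup u i \<ge> 1)"
proof -
  define w :: "'n \<Rightarrow>\<^sub>0 nat" where "w = (\<Sum>i\<in>UNIV. Poly_Mapping.single i 1)"
  have w: "Poly_Mapping.lookup w i = 1" for i
    by (simp add: w_def lookup_sum lookup_single when_def)
  have "(\<Prod>i\<in>A. mpoly_var i) = (Poly_Mapping.single (\<Sum>i\<in>A. Poly_Mapping.single i 1) 1 :: ('n, 'a) mpoly)"
    if "finite A" for A :: "'n set"
    using that by (induction A) (auto simp: mpoly_var_def mult_single)
  hence var: "(\<Prod>i\<in>UNIV. mpoly_var i) = (Poly_Mapping.single w 1 :: ('n, 'a) mpoly)"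
    by (simp add: w_def)
  have "(Poly_Mapping.single w 1 :: ('n, 'a) mpoly) dvd Poly_Mapping.single u 1 \<longleftrightarrow>
      (\<forall>i. Poly_Mapping.lookup u i \<ge> 1)"
  proof
    assume "(Poly_Mapping.single w 1 :: ('n, 'a) mpoly) dvd Poly_Mapping.single u 1"
    then obtain g :: "('n, 'a) mpoly" where "Poly_Mapping.single u 1 = Poly_Mapping.single w 1 * g"
      by (auto simp: dvd_def)
    hence "u \<in> Poly_Mapping.keys (Poly_Mapping.single w 1 * g)"
      by (metis in_keys_iff lookup_single_eq zero_neq_one)
    hence "\<exists>v. u = w + v"
      using keys_mult[of "Poly_Mapping.single w 1" g] by (auto split: if_splits)
    thus "\<forall>i. Poly_Mapping.lookup u i \<ge> 1"
      by (auto simp: lookup_add w)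
  next
    assume "\<forall>i. Poly_Mapping.lookup u i \<ge> 1"
    hence "u = w + (u - w)"
      by (intro poly_mapping_eqI) (metis add_diff_inverse_nat leD lookup_add lookup_minus w)
    hence "Poly_Mapping.single u 1 = Poly_Mapping.single w 1 * (Poly_Mapping.single (u - w) 1 :: ('n, 'a) mpoly)"
      by (simp add: mult_single)
    thus "(Poly_Mapping.single w 1 :: ('n, 'a) mpoly) dvd Poly_Mapping.single u 1" ..
  qed
  thus ?thesis
    by (auto simp: R_monomials_def monomials_def total_degree_def var)
qed

lemma finite_R_monomials: "finite (R_monomials d :: ('n::finite, 'a::field) mpoly set)"
proof -
  have "finite (PiE UNIV (\<lambda>_::'n. {..d}))"
    by (intro finite_PiE) auto
  moreover have "Poly_Mapping.lookup ` {u :: 'n \<Rightarrow>\<^sub>0 nat. mdegree u \<le> d} \<subseteq> PiE UNIV (\<lambda>_. {..d})"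
  proof safe
    fix u :: "'n \<Rightarrow>\<^sub>0 nat" and i
    assume "mdegree u \<le> d"
    moreover have "Poly_Mapping.lookup u i \<le> mdegree u"
      unfolding mdegree_def by (intro member_le_sum) auto
    ultimately show "Poly_Mapping.lookup u i \<le> d" by simp
  qed auto
  ultimately have "finite (Poly_Mapping.lookup ` {u :: 'n \<Rightarrow>\<^sub>0 nat. mdegree u \<le> d})"
    by (rule finite_subset[rotated])
  hence "finite {u :: 'n \<Rightarrow>\<^sub>0 nat. mdegree u \<le> d}"
    by (rule finite_imageD) (auto simp: inj_on_def poly_mapping.lookup_inject)
  hence "finite ((\<lambda>u. Poly_Mapping.single u 1 :: ('n, 'a) mpoly) ` {u. mdegree u \<le> d})"
    by simp
  moreover have "R_monomials d \<subseteq> (\<lambda>u. Poly_Mapping.single u 1 :: ('n, 'a) mpoly) ` {u. mdegree u \<le> d}"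
    by (auto simp: R_monomials_def monomials_def total_degree_def)
  ultimately show ?thesis
    by (rule finite_subset[rotated])
qed

lemma ex_ordered_basis_R_space: "\<exists>bs. ordered_basis mscale (R_space d :: ('n::finite, 'a::field) mpoly set) bs"
proof -
  obtain B :: "('n, 'a) mpoly set" where B: "B \<subseteq> R_monomials d" "mpoly.independent B"
      "R_monomials d \<subseteq> mpoly.span B"
    using mpoly.maximal_independent_subset by blast
  obtain bs where bs: "set bs = B" "distinct bs"
    using finite_distinct_list[OF finite_subset[OF B(1) finite_R_monomials]] by blast
  have "mpoly.span B = R_space d"
    unfolding R_space_def using B mpoly.span_mono mpoly.span_minimal mpoly.subspace_span by blast
  thus ?thesis
    using bs B by (auto simp: ordered_basis_def)
qed

text \<open>The linear extension of \<open>x^u \<mapsto> x^{u/q}\<close> if \<open>q\<close> divides all \<open>u\<^sub>i\<close>, and \<open>x^u \<mapsto> 0\<close> otherwise.\<close>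
definition psi :: "nat \<Rightarrow> ('n::finite, 'a::field) mpoly \<Rightarrow> ('n, 'a) mpoly" where
  "psi q h = (\<Sum>u\<in>Poly_Mapping.keys h.
     if \<forall>i. q dvd Poly_Mapping.lookup u i
     then mscale (Poly_Mapping.lookup h u) (Poly_Mapping.single (Poly_Mapping.map (\<lambda>m. m div q) u) 1)
     else 0)"

lemma psi_superset:
  assumes "finite K" "Poly_Mapping.keys h \<subseteq> K"
  shows "psi q h = (\<Sum>u\<in>K.
     if \<forall>i. q dvd Poly_Mapping.lookup u i
     then mscale (Poly_Mapping.lookup h u) (Poly_Mapping.single (Poly_Mapping.map (\<lambda>m. m div q) u) 1)
     else 0)"
  unfolding psi_def using assms
  by (intro sum.mono_neutral_left) (auto simp: in_keys_iff)

lemma psi_monomial: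
  "psi q (Poly_Mapping.single u 1 :: ('n::finite, 'a::field) mpoly) =
     (if \<forall>i. q dvd Poly_Mapping.lookup u i
      then Poly_Mapping.single (Poly_Mapping.map (\<lambda>m. m div q) u) 1 else 0)"
  by (simp add: psi_superset[of "{u}"])

lemma linear_psi:
  "Vector_Spaces.linear mscale mscale (psi q :: ('n::finite, 'a::field) mpoly \<Rightarrow> ('n, 'a) mpoly)"
proof -
  have "psi q (g + h) = psi q g + psi q h" for g h :: "('n, 'a) mpoly"
  proof -
    define K where "K = Poly_Mapping.keys g \<union> Poly_Mapping.keys h"
    have K: "finite K" "Poly_Mapping.keys g \<subseteq> K" "Poly_Mapping.keys h \<subseteq> K" "Poly_Mapping.keys (g + h) \<subseteq> K"
      using Poly_Mapping.keys_add[of g h] by (auto simp: K_def)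
    show ?thesis
      unfolding psi_superset[OF K(1,2)] psi_superset[OF K(1,3)] psi_superset[OF K(1,4)]
      by (subst sum.distrib[symmetric], intro sum.cong)
        (auto simp: lookup_add mpoly.scale_left_distrib)
  qed
  moreover have "psi q (mscale c h) = mscale c (psi q h)" for c and h :: "('n, 'a) mpoly"
  proof -
    have K: "Poly_Mapping.keys (mscale c h) \<subseteq> Poly_Mapping.keys h"
      by (auto simp: in_keys_iff)
    show ?thesis
      unfolding psi_superset[OF finite_keys K]
      by (auto simp: psi_def mpoly.scale_sum_right if_distrib intro!: sum.cong)
  qed
  ultimately show ?thesis
    by (simp add: Vector_Spaces.linear_iff mpoly.vector_space_axioms)
qed

definition psi_mult :: "('n::finite, 'a::finite_field) mpoly \<Rightarrow> ('n, 'a) mpoly \<Rightarrow> ('n, 'a) mpoly" where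
  "psi_mult f = psi CARD('a) \<circ> (\<lambda>h. f ^ (CARD('a) - 1) * h)"

lemma linear_psi_mult:
  "Vector_Spaces.linear mscale mscale
     (psi_mult f :: ('n::finite, 'a::finite_field) mpoly \<Rightarrow> ('n, 'a) mpoly)"
proof -
  have "f ^ (CARD('a) - 1) * mscale c h = mscale c (f ^ (CARD('a) - 1) * h)" for c h
    by (simp add: mscale_eq_mult mult.left_commute)
  thus ?thesis
    using linear_psi[of "CARD('a)"]
    unfolding Vector_Spaces.linear_iff psi_mult_def comp_def distrib_left by metis
qed


section \<open>Rational points and the zeta function\<close>

text \<open>
  For \<open>k \<ge> 1\<close>, the field with \<open>q^k\<close> elements, as the subfield of the algebraic closure of
  \<open>F_q\<close> fixed by the \<open>q^k\<close>-power map; see \<open>card_ext_field\<close> and \<open>ext_field_closed\<close>.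
\<close>
definition ext_field :: "nat \<Rightarrow> 'a::finite_field alg_closure set" where
  "ext_field k = {x. x ^ (CARD('a) ^ k) = x}"

lemma card_ext_field:
  assumes "k \<ge> 1"
  shows "finite (ext_field k :: 'a::finite_field alg_closure set)"
    and "card (ext_field k :: 'a alg_closure set) = CARD('a) ^ k"
proof -
  define N where "N = CARD('a) ^ k"
  have "card {0, 1 :: 'a} \<le> CARD('a)"
    by (intro card_mono) auto
  hence "CARD('a) > 1" by simp
  hence N: "N > 1" using assms unfolding N_def by (intro one_less_power) auto
  define P :: "'a alg_closure poly" where "P = monom 1 N - monom 1 1"
  have "of_nat CARD('a) = (0 :: 'a)"
  proof -
    have "(\<Sum>x\<in>UNIV. x + 1) = (\<Sum>x\<in>UNIV. x :: 'a)"
      by (rule sum.reindex_bij_witness[of _ "\<lambda>x. x - 1" "\<lambda>x. x + 1"]) auto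
    thus ?thesis by (simp add: sum.distrib)
  qed
  hence "of_nat CARD('a) = (0 :: 'a alg_closure)"
    by (metis to_ac_0 to_ac_of_nat)
  hence N0: "of_nat N = (0 :: 'a alg_closure)"
    using assms by (simp add: N_def)
  have deg: "degree P = N"
    unfolding P_def diff_conv_add_uminus using N by (subst degree_add_eq_left) (auto simp: degree_monom_eq)
  hence "P \<noteq> 0" using N by auto
  obtain A where A: "size A = degree P" "P = smult (lead_coeff P) (\<Prod>x\<in>#A. [:-x, 1:])"
    using alg_closed_imp_factorization[OF \<open>P \<noteq> 0\<close>] by blast
  have pd: "poly (pderiv P) a = -1" for a
    using N0 by (simp add: P_def pderiv_diff pderiv_monom poly_monom)
  have "count A a \<le> 1" for a
  proof (rule ccontr)
    assume "\<not> count A a \<le> 1"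
    hence "a \<in># A" by (metis count_eq_zero_iff zero_le)
    then obtain C where C: "A = add_mset a C" by (metis insert_DiffM)
    with \<open>\<not> count A a \<le> 1\<close> have "a \<in># C" by (auto simp: not_le)
    then obtain B where "A = add_mset a (add_mset a B)"
      using C by (metis insert_DiffM)
    hence "P = [:-a, 1:] * ([:-a, 1:] * smult (lead_coeff P) (\<Prod>x\<in>#B. [:-x, 1:]))"
      by (subst A(2)) (simp add: mult_ac)
    then obtain Q where "P = [:-a, 1:] * ([:-a, 1:] * Q)" by blast
    hence "poly (pderiv P) a = 0"
      by (simp only: pderiv_mult poly_add poly_mult) simp
    thus False using pd by simp
  qed
  moreover have "count A a = 1" if "a \<in># A" "count A a \<le> 1" for a
    using that by (metis One_nat_def Suc_leI count_greater_zero_iff le_antisym)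
  ultimately have "size A = card (set_mset A)"
    by (simp add: size_multiset_overloaded_eq)
  moreover have "set_mset A = ext_field k"
  proof -
    have "x \<in># A \<longleftrightarrow> poly P x = 0" for x
      using \<open>P \<noteq> 0\<close> by (subst A(2)) (auto simp: poly_prod_mset prod_mset_zero_iff)
    thus ?thesis
      by (auto simp: ext_field_def P_def poly_monom N_def)
  qed
  ultimately show "finite (ext_field k :: 'a alg_closure set)"
    and "card (ext_field k :: 'a alg_closure set) = CARD('a) ^ k"
    using A(1) deg N_def by (metis finite_set_mset, metis)
qed

lemma finite_field_binomial_eq_0:
  assumes "0 < i" "i < CARD('a::finite_field)"
  shows "of_nat (CARD('a) choose i) = (0 :: 'a)"
proof -
  let ?q = "CARD('a)"
  define P :: "'a poly" where "P = (\<Sum>i\<in>{0<..<?q}. monom (of_nat (?q choose i)) i)"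
  have q: "?q > 0" by simp
  have "poly P x = 0" for x
  proof -
    have "x + 1 = (x + 1) ^ ?q"
      by (simp add: finite_field_power_card_eq_same)
    also have "\<dots> = (\<Sum>i\<le>?q. of_nat (?q choose i) * x ^ i)"
      by (simp add: binomial_ring)
    also have "{..?q} = insert 0 (insert ?q {0<..<?q})" using q by auto
    also have "(\<Sum>i\<in>\<dots>. of_nat (?q choose i) * x ^ i) = 1 + x ^ ?q + poly P x"
      using q by (simp add: P_def poly_sum poly_monom add_ac)
    also have "x ^ ?q = x" by (rule finite_field_power_card_eq_same)
    finally show ?thesis by simp
  qed
  hence "{x. poly P x = 0} = UNIV" by auto
  moreover have "degree P < ?q"
    unfolding P_def using q
    by (intro le_less_trans[OF degree_sum_le[of _ _ "?q - 1"]])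
       (auto intro: order_trans[OF degree_monom_le])
  ultimately have "P = 0"
    using card_poly_roots_bound[of P] by fastforce
  hence "coeff P i = 0" by simp
  thus ?thesis
    using assms by (simp add: P_def coeff_sum)
qed

lemma add_power_CARD:
  fixes x y :: "'a::finite_field alg_closure"
  shows "(x + y) ^ (CARD('a) ^ k) = x ^ (CARD('a) ^ k) + y ^ (CARD('a) ^ k)"
proof (induction k)
  case (Suc k)
  let ?q = "CARD('a)"
  have step: "(u + v) ^ ?q = u ^ ?q + v ^ ?q" for u v :: "'a alg_closure"
  proof -
    have "(u + v) ^ ?q = (\<Sum>i\<le>?q. of_nat (?q choose i) * u ^ i * v ^ (?q - i))"
      by (rule binomial_ring)
    also have "\<dots> = (\<Sum>i\<in>{0, ?q}. of_nat (?q choose i) * u ^ i * v ^ (?q - i))"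
    proof (intro sum.mono_neutral_right ballI)
      fix i assume "i \<in> {..?q} - {0, ?q}"
      hence "of_nat (?q choose i) = (0 :: 'a)"
        by (intro finite_field_binomial_eq_0) auto
      hence "of_nat (?q choose i) = (0 :: 'a alg_closure)"
        by (metis to_ac_0 to_ac_of_nat)
      thus "of_nat (?q choose i) * u ^ i * v ^ (?q - i) = 0" by simp
    qed auto
    finally show ?thesis by (simp add: add_ac)
  qed
  have "(x + y) ^ (?q ^ Suc k) = ((x + y) ^ (?q ^ k)) ^ ?q"
    by (simp add: power_mult[symmetric] mult.commute)
  thus ?case
    by (simp add: Suc step power_mult[symmetric] mult.commute)
qed auto

lemma ext_field_closed:
  fixes x y :: "'a::finite_field alg_closure"
  assumes "x \<in> ext_field k" "y \<in> ext_field k"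
  shows "x + y \<in> ext_field k" "x - y \<in> ext_field k" "x * y \<in> ext_field k" "inverse x \<in> ext_field k"
    "to_ac (c :: 'a) \<in> ext_field k"
proof -
  have "x = (x - y) ^ (CARD('a) ^ k) + y"
    using assms add_power_CARD[of "x - y" y k] by (simp add: ext_field_def)
  thus "x - y \<in> ext_field k"
    by (simp add: ext_field_def algebra_simps)
  show "to_ac c \<in> ext_field k"
    unfolding ext_field_def
    by (simp add: to_ac_power[symmetric] finite_field_power_card_power_eq_same[OF refl] del: to_ac_power)
qed (use assms in \<open>auto simp: ext_field_def add_power_CARD power_mult_distrib power_inverse\<close>)

definition mpoly_eval :: "('n::finite, 'a::field) mpoly \<Rightarrow> ('n \<Rightarrow> 'a alg_closure) \<Rightarrow> 'a alg_closure" where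
  "mpoly_eval f x =
     (\<Sum>u\<in>Poly_Mapping.keys f. to_ac (Poly_Mapping.lookup f u) * (\<Prod>i\<in>UNIV. x i ^ Poly_Mapping.lookup u i))"

text \<open>The number of \<open>F_{q^k}\<close>-rational points of the affine hypersurface \<open>f = 0\<close>.\<close>
definition num_points :: "('n::finite, 'a::finite_field) mpoly \<Rightarrow> nat \<Rightarrow> nat" where
  "num_points f k = card {x. (\<forall>i. x i \<in> ext_field k) \<and> mpoly_eval f x = 0}"

definition zeta :: "('n::finite, 'a::finite_field) mpoly \<Rightarrow> rat fps" where
  "zeta f = fps_exp 1 oo Abs_fps (\<lambda>k. if k = 0 then 0 else of_nat (num_points f k) / of_nat k)"

text \<open>
  \<open>F\<close> has integer coefficients, and their images under \<open>\<int> \<rightarrow> F_p \<subseteq> F_q\<close>, where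
  \<open>p = CHAR('a)\<close>, are the coefficients of \<open>G\<close>.
\<close>
definition reduces_mod_p :: "rat fps \<Rightarrow> 'a::finite_field fps \<Rightarrow> bool" where
  "reduces_mod_p F G \<longleftrightarrow>
     (\<exists>A :: int fps. F = Abs_fps (\<lambda>k. of_int (fps_nth A k)) \<and> G = Abs_fps (\<lambda>k. of_int (fps_nth A k)))"

end

theory Submission
  imports
    Defs
    "HOL-Algebra.Multiplicative_Group"
    "HOL-Computational_Algebra.Polynomial_FPS"
    "Jordan_Normal_Form.Schur_Decomposition"
begin

text \<open>
  Write \<open>q = CARD('a)\<close>, \<open>n = CARD('n)\<close>, \<open>F = f^(q-1)\<close> and \<open>\<phi> = \<psi>\<^sub>q \<circ> F\<close>. Counting points
  modulo \<open>p\<close> gives \<open>N_k \<equiv> (-1)^(n+1) tr \<phi>^k\<close>, but these congruences do not determine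
  \<open>Z(X,T)\<close> modulo \<open>p\<close>, because \<open>exp (\<Sum> N_k T^k / k)\<close> divides by \<open>k\<close>. The proof therefore
  works with determinants \<open>det (1 - A T)\<close>, which make sense over every commutative ring, commute
  with ring homomorphisms, and in characteristic \<open>0\<close> are determined by the traces of the powers
  of \<open>A\<close>.

  It suffices to compare coefficients of \<open>T^j\<close> for \<open>j \<le> m\<close>. Take \<open>K = m!\<close>, so that the field
  with \<open>q^K\<close> elements contains all fields with \<open>q^k\<close> elements, \<open>k \<le> m\<close>, and let \<open>g\<close> generate
  its multiplicative group. Its affine \<open>n\<close>-space is a finite set permuted by the Frobenius
  map. Three matrices live on this set or on the monomials.

  \<^item> The \<open>0/1\<close>-matrix \<open>P\<close> of the Frobenius map on the points with \<open>f(x) \<noteq> 0\<close>. Its traces count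
    the points outside \<open>X\<close>, hence \<open>Z(X,T) (1 - q^n T)\<close> and \<open>det (1 - P T)\<close> agree up to \<open>T^m\<close>
    (\<open>zeta_eq_det_complement\<close>). Modulo \<open>p\<close> the factor \<open>1 - q^n T\<close> is \<open>1\<close>.

  \<^item> The Frobenius matrix weighted by \<open>F(x)\<close>, over the algebraic closure. Where
    \<open>f(x) \<noteq> 0\<close>, the weight \<open>F(x) = f(x)^q / f(x)\<close> is the quotient of the values of \<open>f\<close> at the
    Frobenius image of \<open>x\<close> and at \<open>x\<close>; elsewhere it is zero. So this matrix
    is conjugate to \<open>P\<close> by a diagonal matrix (\<open>det_weighted_map_coboundary\<close>).

  \<^item> The matrix of \<open>\<phi>\<close>. The relation between the last two is Dwork's trace formula. It is proved in
    characteristic \<open>0\<close>, with the generator \<open>g\<close> replaced by a complex primitive root of unity and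
    the coefficients of \<open>F\<close> replaced by arbitrary lifts: summing a product of values of \<open>F\<close> over
    the fixed points of a power of Frobenius produces an alternating sum of traces over the subsets
    of variables that are required to occur (\<open>trace_teich_mat_power\<close>). The resulting identity
    of determinants has coefficients that are integer polynomials in the root of unity, so it can
    be transported to \<open>g\<close> (\<open>specialize_primitive_root\<close>). In characteristic \<open>p\<close> the matrices
    belonging to proper subsets vanish, being multiples of \<open>q\<close>, and what remains is
    \<open>det (1 - \<phi> T)^((-1)^n)\<close> (\<open>det_identity_mod_p\<close>).
\<close>

section \<open>The determinant of I minus X times a matrix\<close>

definition det_one_minus_X :: "'a::comm_ring_1 mat \<Rightarrow> 'a poly" where
  "det_one_minus_X A = Determinant.det (1\<^sub>m (dim_row A) - [:0, 1:] \<cdot>\<^sub>m map_mat (\<lambda>c. [:c:]) A)"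

lemma det_I_minus_T: "Determinant.det (I_minus_T A) = det_one_minus_X A"
  by (simp add: I_minus_T_def det_one_minus_X_def)

text \<open>
  Identities between such determinants can thus be proved over one ring and be transported to another
  one; this is how characteristic \<open>0\<close> enters the proof.
\<close>
lemma det_one_minus_X_hom:
  assumes "comm_ring_hom h" "A \<in> carrier_mat n n"
  shows "det_one_minus_X (map_mat h A) = map_poly h (det_one_minus_X A)"
proof -
  interpret h: comm_ring_hom h by fact
  interpret mp: map_poly_comm_ring_hom h ..
  have lin: "map_poly h [:a, b:] = [:h a, h b:]" for a b
    by (intro poly_eqI) (simp add: coeff_map_poly coeff_pCons split: nat.split)
  have "map_mat (map_poly h) (1\<^sub>m n - [:0, 1:] \<cdot>\<^sub>m map_mat (\<lambda>c. [:c:]) A)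
      = 1\<^sub>m n - [:0, 1:] \<cdot>\<^sub>m map_mat (\<lambda>c. [:c:]) (map_mat h A)"
  proof (rule eq_matI)
    fix i j assume "i < dim_row (1\<^sub>m n - [:0, 1:] \<cdot>\<^sub>m map_mat (\<lambda>c. [:c:]) (map_mat h A))"
      "j < dim_col (1\<^sub>m n - [:0, 1:] \<cdot>\<^sub>m map_mat (\<lambda>c. [:c:]) (map_mat h A))"
    hence "i < n" "j < n" using assms(2) by auto
    thus "map_mat (map_poly h) (1\<^sub>m n - [:0, 1:] \<cdot>\<^sub>m map_mat (\<lambda>c. [:c:]) A) $$ (i, j)
        = (1\<^sub>m n - [:0, 1:] \<cdot>\<^sub>m map_mat (\<lambda>c. [:c:]) (map_mat h A)) $$ (i, j)"
      using assms(2) by (simp add: mp.hom_minus lin one_pCons)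
  qed (use assms(2) in auto)
  thus ?thesis
    using assms(2) by (simp add: det_one_minus_X_def flip: mp.hom_det)
qed

lemma det_one_minus_X_similar:
  fixes A B :: "'a::comm_ring_1 mat"
  assumes "similar_mat A B"
  shows "det_one_minus_X A = det_one_minus_X B"
proof -
  obtain n P Q where c: "A \<in> carrier_mat n n" "B \<in> carrier_mat n n" "P \<in> carrier_mat n n" "Q \<in> carrier_mat n n"
    and PQ: "P * Q = 1\<^sub>m n" "Q * P = 1\<^sub>m n" and A: "A = P * B * Q"
    using similar_matD[OF assms] by auto
  define L where "L = map_mat (\<lambda>c::'a. [:c:])"
  define M where "M A = 1\<^sub>m n - [:0, 1:] \<cdot>\<^sub>m L A" for A
  interpret hom: comm_ring_hom "\<lambda>c::'a. [:c:]" by standard auto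
  have [simp]: "L A \<in> carrier_mat n n" if "A \<in> carrier_mat n n" for A
    using that by (simp add: L_def)
  have [simp]: "M A \<in> carrier_mat n n" if "A \<in> carrier_mat n n" for A
    using that by (simp add: M_def minus_carrier_mat)
  have Lmult: "L (A * B) = L A * L B" if "A \<in> carrier_mat n n" "B \<in> carrier_mat n n" for A B
    unfolding L_def using that by (rule hom.mat_hom_mult)
  have "L P * M B = (L P - [:0, 1:] \<cdot>\<^sub>m (L P * L B))"
    unfolding M_def using c
    by (subst mult_minus_distrib_mat[of _ n n _ n]) (auto simp: mult_smult_distrib[of _ n n _ n] right_mult_one_mat[of _ n n])
  moreover have "M A * L P = (L P - [:0, 1:] \<cdot>\<^sub>m (L A * L P))"
    unfolding M_def using c
    by (subst minus_mult_distrib_mat[of _ n n _ _ n]) (auto simp: mult_smult_assoc_mat[of _ n n _ n] left_mult_one_mat[of _ n n])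
  moreover have "A * P = P * B"
    using c PQ unfolding A by (simp add: assoc_mult_mat[of _ n n _ n _ n])
  ultimately have "L P * M B = M A * L P"
    using c by (simp flip: Lmult)
  from arg_cong[OF this, of Determinant.det]
  have "Determinant.det (L P) * Determinant.det (M B) = Determinant.det (M A) * Determinant.det (L P)"
    using c by (simp add: det_mult[of _ n])
  moreover have "Determinant.det (L Q) * Determinant.det (L P) = 1"
  proof -
    have "Determinant.det (L Q) * Determinant.det (L P) = Determinant.det (L (Q * P))"
      using c by (simp add: det_mult[of _ n] Lmult)
    thus ?thesis by (simp add: PQ L_def hom.mat_hom_one)
  qed
  moreover have "y = z" if "x * z = y * x" "w * x = 1" for w x y z :: "'a poly"
  proof -
    have "y = y * (w * x)" using that by simp
    also have "\<dots> = w * (y * x)" by (simp add: mult_ac)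
    also have "\<dots> = (w * x) * z" using that(1) by (simp add: mult_ac)
    finally show ?thesis using that by simp
  qed
  ultimately have "Determinant.det (M A) = Determinant.det (M B)"
    by blast
  thus ?thesis using c by (simp add: det_one_minus_X_def M_def L_def)
qed

lemma det_one_minus_X_upper_triangular:
  fixes A :: "'a::comm_ring_1 mat"
  assumes "A \<in> carrier_mat n n" "upper_triangular A"
  shows "det_one_minus_X A = (\<Prod>i<n. [:1, - A $$ (i, i):])"
proof -
  define M where "M = 1\<^sub>m n - [:0, 1:] \<cdot>\<^sub>m map_mat (\<lambda>c. [:c:]) A"
  have M: "M \<in> carrier_mat n n" using assms by (auto simp: M_def)
  have "upper_triangular M"
    using assms by (auto simp: M_def upper_triangular_def)
  hence "Determinant.det M = prod_list (diag_mat M)"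
    using M by (rule det_upper_triangular)
  also have "\<dots> = (\<Prod>i<n. [:1, - A $$ (i, i):])"
    using M assms unfolding prod_list_diag_prod
    by (auto simp: M_def lessThan_atLeast0 one_pCons intro!: prod.cong)
  finally show ?thesis using assms by (simp add: det_one_minus_X_def M_def)
qed

definition mat_trace :: "'a::comm_ring_1 mat \<Rightarrow> 'a" where
  "mat_trace A = (\<Sum>i<dim_row A. A $$ (i, i))"

lemma mat_trace_mult_commute:
  assumes "A \<in> carrier_mat n n" "B \<in> carrier_mat n n"
  shows "mat_trace (A * B) = mat_trace (B * A)"
proof -
  have "mat_trace (A * B) = (\<Sum>i<n. \<Sum>j<n. A $$ (i, j) * B $$ (j, i))"
    using assms by (auto simp: mat_trace_def scalar_prod_def lessThan_atLeast0)
  also have "\<dots> = (\<Sum>j<n. \<Sum>i<n. A $$ (i, j) * B $$ (j, i))"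
    by (rule sum.swap)
  also have "\<dots> = mat_trace (B * A)"
    using assms by (auto simp: mat_trace_def scalar_prod_def lessThan_atLeast0 mult.commute)
  finally show ?thesis .
qed

lemma mat_trace_similar:
  assumes "similar_mat A B"
  shows "mat_trace A = mat_trace B"
proof -
  obtain n P Q where c: "A \<in> carrier_mat n n" "B \<in> carrier_mat n n" "P \<in> carrier_mat n n" "Q \<in> carrier_mat n n"
    and PQ: "P * Q = 1\<^sub>m n" "Q * P = 1\<^sub>m n" and A: "A = P * B * Q"
    using similar_matD[OF assms] by auto
  have "mat_trace A = mat_trace (Q * (P * B))"
    unfolding A using c by (intro mat_trace_mult_commute) auto
  also have "Q * (P * B) = B"
    using c PQ by (simp flip: assoc_mult_mat[of _ n n _ n _ n])
  finally show ?thesis .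
qed

lemma upper_triangular_mult:
  fixes A B :: "'a::comm_ring_1 mat"
  assumes c: "A \<in> carrier_mat n n" "B \<in> carrier_mat n n" and u: "upper_triangular A" "upper_triangular B"
  shows "upper_triangular (A * B)" and "i < n \<Longrightarrow> (A * B) $$ (i, i) = A $$ (i, i) * B $$ (i, i)"
proof -
  have z: "A $$ (i, k) * B $$ (k, j) = 0" if "i < n" "k < n" "k < i \<or> j < k" for i j k
    using that c u by (auto simp: upper_triangular_def)
  have e: "(A * B) $$ (i, j) = (\<Sum>k<n. A $$ (i, k) * B $$ (k, j))" if "i < n" "j < n" for i j
    using c that by (auto simp: scalar_prod_def lessThan_atLeast0)
  show "upper_triangular (A * B)"
  proof (intro upper_triangularI)
    fix i j assume "j < i" "i < dim_row (A * B)"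
    hence ij: "j < i" "i < n" using c by auto
    have "(\<Sum>k<n. A $$ (i, k) * B $$ (k, j)) = 0"
      using ij z by (intro sum.neutral) (metis lessThan_iff linorder_neqE_nat less_trans)
    thus "(A * B) $$ (i, j) = 0" using ij by (simp add: e)
  qed
  assume i: "i < n"
  have "(\<Sum>k<n. A $$ (i, k) * B $$ (k, i)) = (\<Sum>k\<in>{i}. A $$ (i, k) * B $$ (k, i))"
    using i z by (intro sum.mono_neutral_right ballI) (auto simp: nat_neq_iff)
  thus "(A * B) $$ (i, i) = A $$ (i, i) * B $$ (i, i)" using i by (simp add: e)
qed

lemma upper_triangular_power:
  fixes A :: "'a::comm_ring_1 mat"
  assumes c: "A \<in> carrier_mat n n" and u: "upper_triangular A"
  shows "upper_triangular (A ^\<^sub>m k) \<and> (\<forall>i<n. (A ^\<^sub>m k) $$ (i, i) = (A $$ (i, i)) ^ k)"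
proof (induction k)
  case 0
  show ?case using c by auto
next
  case (Suc k)
  have "A ^\<^sub>m k \<in> carrier_mat n n" using c by simp
  from upper_triangular_mult[OF this c _ u] show ?case using Suc c by (auto simp: mult.commute)
qed

section \<open>Logarithmic derivatives of power series\<close>

text \<open>
  In characteristic \<open>0\<close> this says \<open>F = exp (\<Sum> s\<^sub>k T^k / k)\<close>. In the form \<open>T F' = s F\<close> it is a linear
  recursion for the coefficients, and products visibly correspond to sums.
\<close>
definition log_derivative :: "'a::comm_ring_1 fps \<Rightarrow> 'a fps \<Rightarrow> bool" where
  "log_derivative F s \<longleftrightarrow> fps_nth F 0 = 1 \<and> fps_X * fps_deriv F = s * F"

lemma log_derivative_1 [simp]: "log_derivative 1 0"
  by (simp add: log_derivative_def)

lemma log_derivative_mult: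
  assumes "log_derivative F s" "log_derivative G t"
  shows "log_derivative (F * G) (s + t)"
proof -
  have "fps_X * fps_deriv (F * G) = (fps_X * fps_deriv F) * G + F * (fps_X * fps_deriv G)"
    by (simp add: algebra_simps)
  also have "\<dots> = (s + t) * (F * G)"
    using assms by (simp add: log_derivative_def algebra_simps)
  finally show ?thesis using assms by (simp add: log_derivative_def)
qed

lemma log_derivative_prod:
  "(\<And>i. i \<in> I \<Longrightarrow> log_derivative (F i) (s i)) \<Longrightarrow> log_derivative (\<Prod>i\<in>I. F i) (\<Sum>i\<in>I. s i)"
  by (induction I rule: infinite_finite_induct) (auto intro: log_derivative_mult)

text \<open>
  The relation \<open>T F' = s F\<close> is the recursion \<open>j F\<^sub>j = \<Sum> s\<^sub>i F\<^sub>j\<^sub>-\<^sub>i\<close>. It can be solved for \<open>F\<^sub>j\<close> in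
  characteristic \<open>0\<close>, since \<open>s\<^sub>0 = 0\<close>, and only uses the coefficients of \<open>s\<close> up to \<open>j\<close>.
\<close>
lemma log_derivative_unique:
  fixes F G :: "'a::field_char_0 fps"
  assumes F: "log_derivative F s" and G: "log_derivative G t"
    and st: "\<And>j. j \<le> m \<Longrightarrow> fps_nth s j = fps_nth t j" and "j \<le> m"
  shows "fps_nth F j = fps_nth G j"
  using \<open>j \<le> m\<close>
proof (induction j rule: less_induct)
  case (less j)
  have rec: "of_nat j * fps_nth H j = (\<Sum>i=0..j. fps_nth r i * fps_nth H (j - i))" if "log_derivative H r" for H r :: "'a fps"
  proof -
    have "of_nat j * fps_nth H j = fps_nth (fps_X * fps_deriv H) j"
      by (cases j) (simp_all add: algebra_simps)
    also have "\<dots> = fps_nth (r * H) j" using that by (simp add: log_derivative_def)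
    finally show ?thesis by (simp add: fps_mult_nth)
  qed
  have s0: "fps_nth r 0 = 0" if "log_derivative H r" for H r :: "'a fps"
  proof -
    have "fps_nth (fps_X * fps_deriv H) 0 = fps_nth (r * H) 0"
      using that by (simp only: log_derivative_def)
    thus ?thesis using that by (simp add: log_derivative_def)
  qed
  show ?case
  proof (cases "j = 0")
    case True
    thus ?thesis using F G by (simp add: log_derivative_def)
  next
    case False
    have "(\<Sum>i=0..j. fps_nth s i * fps_nth F (j - i)) = (\<Sum>i=0..j. fps_nth t i * fps_nth G (j - i))"
    proof (intro sum.cong refl)
      fix i assume i: "i \<in> {0..j}"
      show "fps_nth s i * fps_nth F (j - i) = fps_nth t i * fps_nth G (j - i)"
      proof (cases "i = 0")
        case True thus ?thesis using s0[OF F] s0[OF G] by simp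
      next
        case False
        hence "fps_nth F (j - i) = fps_nth G (j - i)"
          using i less \<open>j \<noteq> 0\<close> by auto
        thus ?thesis using st[of i] i less.prems by auto
      qed
    qed
    hence "of_nat j * fps_nth F j = of_nat j * fps_nth G j"
      using rec[OF F] rec[OF G] by simp
    thus ?thesis using False by simp
  qed
qed

lemma log_derivative_map:
  assumes "comm_ring_hom h" "log_derivative F s"
  shows "log_derivative (Abs_fps (\<lambda>k. h (fps_nth F k))) (Abs_fps (\<lambda>k. h (fps_nth s k)))"
proof -
  interpret comm_ring_hom h by fact
  have eq: "fps_X * fps_deriv F = s * F" and 1: "fps_nth F 0 = 1" using assms(2) by (auto simp: log_derivative_def)
  have "fps_X * fps_deriv (Abs_fps (\<lambda>k. h (fps_nth F k))) = Abs_fps (\<lambda>k. h (fps_nth (fps_X * fps_deriv F) k))"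
    by (rule fps_ext) (simp add: hom_distribs)
  also have "\<dots> = Abs_fps (\<lambda>k. h (fps_nth s k)) * Abs_fps (\<lambda>k. h (fps_nth F k))"
    unfolding eq by (rule fps_ext) (simp add: fps_mult_nth hom_distribs)
  finally show ?thesis using 1 by (simp add: log_derivative_def)
qed

definition trace_series :: "(nat \<Rightarrow> 'a::zero) \<Rightarrow> 'a fps" where
  "trace_series a = Abs_fps (\<lambda>k. if k = 0 then 0 else a k)"

lemma log_derivative_linear_factor:
  fixes a :: "'a::comm_ring_1"
  shows "log_derivative (fps_of_poly [:1, -a:]) (trace_series (\<lambda>k. - (a ^ k)))"
  unfolding log_derivative_def
proof
  show "fps_X * fps_deriv (fps_of_poly [:1, -a:]) = trace_series (\<lambda>k. - (a ^ k)) * fps_of_poly [:1, -a:]"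
  proof (rule fps_ext)
    fix j
    have *: "fps_of_poly [:1, -a:] = 1 - fps_const a * fps_X"
      by (simp add: fps_of_poly_pCons)
    have "trace_series (\<lambda>k. - (a ^ k)) * fps_of_poly [:1, -a:]
        = trace_series (\<lambda>k. - (a ^ k)) - fps_const a * (fps_X * trace_series (\<lambda>k. - (a ^ k)))"
      by (simp add: * algebra_simps)
    moreover have "fps_X * fps_deriv (fps_of_poly [:1, -a:]) = - (fps_const a * fps_X)"
      by (simp add: * mult.commute)
    ultimately show "fps_nth (fps_X * fps_deriv (fps_of_poly [:1, -a:])) j
        = fps_nth (trace_series (\<lambda>k. - (a ^ k)) * fps_of_poly [:1, -a:]) j"
      by (cases j; cases "j - 1") (simp_all add: trace_series_def)
  qed
qed simp

text \<open>
  After Schur triangularisation both sides are expressed by the eigenvalues: the determinant is a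
  product of linear factors, and the trace of a power is a power sum.
\<close>
lemma log_derivative_det:
  fixes A :: "complex mat"
  assumes A: "A \<in> carrier_mat n n"
  shows "log_derivative (fps_of_poly (det_one_minus_X A)) (trace_series (\<lambda>k. - mat_trace (A ^\<^sub>m k)))"
proof -
  obtain es where "char_poly A = (\<Prod>a\<leftarrow>es. [:- a, 1:])"
    using char_poly_factorized[OF A] by blast
  then obtain B where B: "B \<in> carrier_mat n n" "upper_triangular B" "similar_mat A B"
    using schur_decomposition_exists[OF A] by blast
  have "similar_mat (A ^\<^sub>m k) (B ^\<^sub>m k)" for k
    using B(3) unfolding similar_mat_def by (blast intro: similar_mat_wit_pow)
  hence tr: "mat_trace (A ^\<^sub>m k) = (\<Sum>i<n. (B $$ (i, i)) ^ k)" for k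
    using upper_triangular_power[OF B(1,2), of k] B(1)
    by (subst mat_trace_similar) (auto simp: mat_trace_def)
  have "log_derivative (\<Prod>i<n. fps_of_poly [:1, - B $$ (i, i):])
     (\<Sum>i<n. trace_series (\<lambda>k. - (B $$ (i, i) ^ k)))"
    by (intro log_derivative_prod log_derivative_linear_factor)
  also have "(\<Sum>i<n. trace_series (\<lambda>k. - (B $$ (i, i) ^ k))) = trace_series (\<lambda>k. - mat_trace (A ^\<^sub>m k))"
    by (rule fps_ext) (simp add: trace_series_def tr fps_sum_nth sum_negf)
  also have "(\<Prod>i<n. fps_of_poly [:1, - B $$ (i, i):]) = fps_of_poly (det_one_minus_X A)"
    by (simp add: det_one_minus_X_similar[OF B(3)] det_one_minus_X_upper_triangular[OF B(1,2)] fps_of_poly_prod)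
  finally show ?thesis .
qed

section \<open>Specialising primitive roots of unity\<close>

definition int_poly_eval :: "'a::comm_ring_1 \<Rightarrow> int poly \<Rightarrow> 'a" where
  "int_poly_eval z c = poly (map_poly of_int c) z"

lemma comm_ring_hom_int_poly_eval: "comm_ring_hom (int_poly_eval z)"
  by standard (simp_all add: int_poly_eval_def hom_distribs)

interpretation int_poly_eval: comm_ring_hom "int_poly_eval z"
  by (rule comm_ring_hom_int_poly_eval)

lemma int_poly_eval_monom [simp]: "int_poly_eval z (monom a n) = of_int a * z ^ n"
  by (simp add: int_poly_eval_def map_poly_monom poly_monom)

definition primitive_root :: "nat \<Rightarrow> 'a::comm_ring_1 \<Rightarrow> bool" where
  "primitive_root N z \<longleftrightarrow> z ^ N = 1 \<and> (\<forall>M. 0 < M \<and> M < N \<longrightarrow> z ^ M \<noteq> 1)"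

lemma primitive_root_power_eq_1_iff:
  assumes "primitive_root N z" "N > 0"
  shows "z ^ a = 1 \<longleftrightarrow> N dvd a"
proof -
  have "z ^ a = z ^ (N * (a div N) + a mod N)" by simp
  also have "\<dots> = z ^ (a mod N)"
    using assms unfolding power_add power_mult primitive_root_def by simp
  finally have "z ^ a = z ^ (a mod N)" .
  moreover have "a mod N < N" using assms by simp
  ultimately show ?thesis
    using assms by (metis dvd_eq_mod_eq_0 gr0I power_0 primitive_root_def)
qed

text \<open>
  An integral polynomial relation satisfied by all complex primitive \<open>N\<close>-th roots of unity holds for
  any element of order \<open>N\<close> in any domain. The reason is that multiplying \<open>c\<close> by \<open>E = \<Prod> (x^M - 1)\<close>, over \<open>0 < M < N\<close>, makes it vanish at all complex
  \<open>N\<close>-th roots of unity, so that \<open>x^N - 1\<close> divides \<open>c E\<close> over the integers; and \<open>E\<close> does not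
  vanish at an element of order \<open>N\<close>.
\<close>
lemma specialize_primitive_root:
  fixes c :: "int poly" and g :: "'a::idom"
  assumes g: "primitive_root N g" and N: "N > 0"
    and c: "\<And>z :: complex. primitive_root N z \<Longrightarrow> int_poly_eval z c = 0"
  shows "int_poly_eval g c = 0"
proof -
  define P :: "int poly" where "P = monom 1 N - 1"
  define E :: "int poly" where "E = (\<Prod>M\<in>{1..<N}. monom 1 M - 1)"
  have deg: "degree P = N" "lead_coeff P = 1"
  proof -
    have "degree (monom 1 N + (-1) :: int poly) = N"
      using N by (subst degree_add_eq_left) (auto simp: degree_monom_eq)
    thus "degree P = N" by (simp add: P_def)
    thus "lead_coeff P = 1" using N by (simp add: P_def)
  qed
  hence "P \<noteq> 0" by auto
  define Q R where "Q = fst (pseudo_divmod (c * E) P)" and "R = snd (pseudo_divmod (c * E) P)"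
  have qr: "pseudo_divmod (c * E) P = (Q, R)" by (simp add: Q_def R_def)
  have div: "c * E = P * Q + R" and R: "R = 0 \<or> degree R < N"
    using pseudo_divmod[OF \<open>P \<noteq> 0\<close> qr] deg by auto
  have P0: "int_poly_eval z P = 0" if "z ^ N = 1" for z :: "'b::comm_ring_1"
    using that by (simp add: P_def int_poly_eval.hom_minus)
  have E: "int_poly_eval z E = (\<Prod>M\<in>{1..<N}. z ^ M - 1)" for z :: "'b::comm_ring_1"
    by (simp add: E_def int_poly_eval.hom_prod int_poly_eval.hom_minus)
  \<comment> \<open>The remainder vanishes at the \<open>N\<close> complex \<open>N\<close>-th roots of unity, but has degree less than \<open>N\<close>.\<close>
  have "R = 0"
  proof (rule ccontr)
    assume "R \<noteq> 0"
    define R' :: "complex poly" where "R' = map_poly of_int R"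
    have R': "R' \<noteq> 0" "degree R' < N"
      using R \<open>R \<noteq> 0\<close> by (auto simp: R'_def degree_map_poly)
    have "{z::complex. z ^ N = 1} \<subseteq> {z. poly R' z = 0}"
    proof safe
      fix z :: complex assume z: "z ^ N = 1"
      have "int_poly_eval z (c * E) = 0"
      proof (cases "primitive_root N z")
        case True
        thus ?thesis using c by (simp add: int_poly_eval.hom_mult)
      next
        case False
        hence "int_poly_eval z E = 0" using z by (auto simp: E primitive_root_def)
        thus ?thesis by (simp add: int_poly_eval.hom_mult)
      qed
      thus "poly R' z = 0"
        using z by (simp add: div int_poly_eval.hom_add int_poly_eval.hom_mult P0)
          (simp add: int_poly_eval_def R'_def)
    qed
    hence "card {z::complex. z ^ N = 1} \<le> card {z. poly R' z = 0}"
      using R' by (intro card_mono poly_roots_finite)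
    also have "\<dots> \<le> degree R'" by (intro card_poly_roots_bound R')
    finally show False using R' N by (simp add: card_roots_unity_eq)
  qed
  have "int_poly_eval g c * int_poly_eval g E = int_poly_eval g (P * Q)"
    using div \<open>R = 0\<close> by (simp flip: int_poly_eval.hom_mult)
  also have "\<dots> = 0"
    using g by (simp add: int_poly_eval.hom_mult P0 primitive_root_def)
  finally have "int_poly_eval g c * int_poly_eval g E = 0" .
  moreover have "int_poly_eval g E \<noteq> 0"
    using g by (auto simp: E primitive_root_def)
  ultimately show ?thesis by simp
qed

lemma card_finite_field_gt_1: "CARD('a::finite_field) > 1"
proof -
  have "card {0, 1 :: 'a} \<le> CARD('a)"
    by (intro card_mono) auto
  thus ?thesis by simp
qed

lemma exists_generator_ext_field:
  assumes K: "K \<ge> 1"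
  defines "N \<equiv> CARD('a) ^ K - 1"
  shows "\<exists>g :: 'a::finite_field alg_closure. primitive_root N g \<and> ext_field K - {0} = (\<lambda>j. g ^ j) ` {..<N}"
proof -
  define F where "F = (ext_field K :: 'a alg_closure set)"
  define R where "R = \<lparr>carrier = (F :: 'a alg_closure set), monoid.mult = (*), one = (1 :: 'a alg_closure),
    zero = (0 :: 'a alg_closure), add = (+)\<rparr>"
  have F: "0 \<in> F" "1 \<in> F" "\<And>x y. x \<in> F \<Longrightarrow> y \<in> F \<Longrightarrow> x + y \<in> F"
     "\<And>x y. x \<in> F \<Longrightarrow> y \<in> F \<Longrightarrow> x * y \<in> F" "\<And>x. x \<in> F \<Longrightarrow> inverse x \<in> F" "\<And>x. x \<in> F \<Longrightarrow> -x \<in> F"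
  proof -
    show z: "0 \<in> F" "1 \<in> F" by (simp_all add: F_def ext_field_def)
    show "-x \<in> F" if "x \<in> F" for x using ext_field_closed(2)[of 0 K x] z that by (simp add: F_def)
  qed (auto simp: F_def intro: ext_field_closed)
  have fin: "finite F" and card: "card F = CARD('a) ^ K"
    using card_ext_field[OF K] by (simp_all add: F_def)
  have N: "N > 0"
    using one_less_power[OF card_finite_field_gt_1[where 'a='a], of K] K by (simp add: N_def)
  have R [simp]: "carrier R = F" "x \<otimes>\<^bsub>R\<^esub> y = x * y" "\<one>\<^bsub>R\<^esub> = 1" "\<zero>\<^bsub>R\<^esub> = 0" "x \<oplus>\<^bsub>R\<^esub> y = x + y" for x y
    by (simp_all add: R_def)
  have cring: "cring R"
  proof (intro cringI abelian_groupI comm_monoidI)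
    fix x assume "x \<in> carrier R"
    thus "\<exists>y\<in>carrier R. y \<oplus>\<^bsub>R\<^esub> x = \<zero>\<^bsub>R\<^esub>"
      using F(6) by (intro bexI[of _ "-x"]) simp_all
  qed (simp_all add: F algebra_simps)
  have "field R"
  proof (rule cring.cring_fieldI2[OF cring])
    show "\<zero>\<^bsub>R\<^esub> \<noteq> \<one>\<^bsub>R\<^esub>" by simp
    fix x assume "x \<in> carrier R" "x \<noteq> \<zero>\<^bsub>R\<^esub>"
    thus "\<exists>y\<in>carrier R. x \<otimes>\<^bsub>R\<^esub> y = \<one>\<^bsub>R\<^esub>"
      using F(5) by (intro bexI[of _ "inverse x"]) simp_all
  qed
  then interpret R: field R .
  have pow: "x [^]\<^bsub>R\<^esub> (i::nat) = x ^ i" for x i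
    by (induction i) (simp_all add: R.nat_pow_0 R.nat_pow_Suc mult.commute)
  have fin': "finite (carrier R)" using fin by simp
  obtain g where g: "g \<in> carrier (Multiplicative_Group.mult_of R)"
      and gen: "carrier (Multiplicative_Group.mult_of R) = {g [^]\<^bsub>R\<^esub> i | i::nat. i \<in> UNIV}"
    using R.finite_field_mult_group_has_gen[OF fin'] unfolding Multiplicative_Group.nat_pow_mult_of by blast
  have gen': "F - {0} = range (\<lambda>i. g ^ i)"
    using gen unfolding pow Multiplicative_Group.carrier_mult_of R by auto
  have cardF: "card (F - {0}) = N" using card fin F by (simp add: N_def)
  have "g \<in> F" "g \<noteq> 0" using g unfolding Multiplicative_Group.carrier_mult_of R by auto
  hence "g * g ^ N = g * 1"
    using N by (simp add: F_def ext_field_def N_def flip: power_Suc)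
  hence gN: "g ^ N = 1" using \<open>g \<noteq> 0\<close> by simp
  have range: "range (\<lambda>i. g ^ i) = (\<lambda>i. g ^ i) ` {..<M}" if M: "M > 0" "g ^ M = 1" for M
  proof safe
    fix i
    have "g ^ i = g ^ (M * (i div M) + i mod M)" by simp
    also have "\<dots> = g ^ (i mod M)" using M unfolding power_add power_mult by simp
    finally show "g ^ i \<in> (\<lambda>i. g ^ i) ` {..<M}" using M by auto
  qed auto
  have "g ^ M \<noteq> 1" if "0 < M" "M < N" for M
  proof
    assume "g ^ M = 1"
    hence "N \<le> card {..<M}"
      using cardF range[OF \<open>0 < M\<close>] gen' card_image_le[of "{..<M}" "\<lambda>i. g ^ i"] by simp
    thus False using that by simp
  qed
  thus ?thesis using gN range[OF N gN] gen' by (auto simp: primitive_root_def F_def)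
qed

section \<open>Matrices indexed by finite sets\<close>

definition enum_set :: "'b set \<Rightarrow> 'b list" where
  "enum_set A = (SOME xs. set xs = A \<and> distinct xs)"

lemma enum_set: "finite A \<Longrightarrow> set (enum_set A) = A" "finite A \<Longrightarrow> distinct (enum_set A)"
  using someI_ex[OF finite_distinct_list, of A] by (auto simp: enum_set_def)

lemma length_enum_set: "finite A \<Longrightarrow> length (enum_set A) = card A"
  using enum_set distinct_card by metis

lemma sum_enum_set:
  assumes "finite A"
  shows "(\<Sum>i<card A. h (enum_set A ! i)) = (\<Sum>a\<in>A. h a)"
  using assms bij_betw_nth[of "enum_set A" "{..<card A}" A]
  by (intro sum.reindex_bij_betw) (auto simp: enum_set length_enum_set)

lemma enum_set_nth: "finite A \<Longrightarrow> i < card A \<Longrightarrow> enum_set A ! i \<in> A"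
  using enum_set length_enum_set nth_mem by metis

definition mat_on :: "'b set \<Rightarrow> ('b \<Rightarrow> 'b \<Rightarrow> 'a) \<Rightarrow> 'a mat" where
  "mat_on A h = mat (card A) (card A) (\<lambda>(i, j). h (enum_set A ! i) (enum_set A ! j))"

lemma mat_on_carrier [simp]: "mat_on A h \<in> carrier_mat (card A) (card A)"
  by (simp add: mat_on_def)

lemma map_mat_mat_on: "map_mat f (mat_on A h) = mat_on A (\<lambda>a b. f (h a b))"
  by (intro eq_matI) (auto simp: mat_on_def)

lemma mat_on_cong:
  assumes "finite A" "\<And>a b. a \<in> A \<Longrightarrow> b \<in> A \<Longrightarrow> h a b = h' a b"
  shows "mat_on A h = mat_on A h'"
  using assms by (intro eq_matI) (auto simp: mat_on_def enum_set_nth)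

lemma mat_on_mult:
  assumes "finite A"
  shows "mat_on A h * mat_on A h' = mat_on A (\<lambda>a b. \<Sum>c\<in>A. h a c * h' c b)"
  using sum_enum_set[OF assms]
  by (intro eq_matI) (auto simp: mat_on_def scalar_prod_def lessThan_atLeast0)

lemma mat_on_1:
  assumes "finite A"
  shows "mat_on A (\<lambda>a b. of_bool (a = b)) = 1\<^sub>m (card A)"
  using assms by (intro eq_matI) (auto simp: mat_on_def nth_eq_iff_index_eq enum_set length_enum_set)

lemma mat_on_power:
  fixes h :: "'b \<Rightarrow> 'b \<Rightarrow> 'a::comm_ring_1"
  assumes A: "finite A"
    and h0: "\<And>a b. a \<in> A \<Longrightarrow> b \<in> A \<Longrightarrow> hk 0 a b = of_bool (a = b)"
    and hS: "\<And>k a b. a \<in> A \<Longrightarrow> b \<in> A \<Longrightarrow> hk (Suc k) a b = (\<Sum>c\<in>A. h a c * hk k c b)"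
  shows "mat_on A h ^\<^sub>m k = mat_on A (hk k)"
proof (induction k)
  case 0
  have "mat_on A (hk 0) = 1\<^sub>m (card A)"
    unfolding mat_on_1[OF A, symmetric] using h0 by (intro mat_on_cong[OF A])
  thus ?case by (simp add: mat_on_def)
next
  case (Suc k)
  have c: "mat_on A h ^\<^sub>m i \<in> carrier_mat (card A) (card A)" for i by simp
  have comm: "mat_on A h ^\<^sub>m i * mat_on A h = mat_on A h * mat_on A h ^\<^sub>m i" for i
  proof (induction i)
    case 0
    show ?case using mat_on_carrier[of A h] by (simp add: mat_on_def)
  next
    case (Suc i)
    have "mat_on A h ^\<^sub>m Suc i * mat_on A h = (mat_on A h * mat_on A h ^\<^sub>m i) * mat_on A h"
      using Suc by simp
    also have "\<dots> = mat_on A h * (mat_on A h ^\<^sub>m i * mat_on A h)"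
      by (rule assoc_mult_mat[OF mat_on_carrier c mat_on_carrier])
    finally show ?case by simp
  qed
  have "mat_on A h ^\<^sub>m Suc k = mat_on A h * mat_on A h ^\<^sub>m k" using comm[of k] by simp
  also have "\<dots> = mat_on A (\<lambda>a b. \<Sum>c\<in>A. h a c * hk k c b)" unfolding Suc by (rule mat_on_mult[OF A])
  also have "\<dots> = mat_on A (hk (Suc k))" using hS by (intro mat_on_cong[OF A]) simp
  finally show ?case .
qed

lemma mat_trace_mat_on: "finite A \<Longrightarrow> mat_trace (mat_on A h) = (\<Sum>a\<in>A. h a a)"
  using sum_enum_set[of A "\<lambda>a. h a a"] by (simp add: mat_trace_def mat_on_def)

text \<open>
  The common form of the Frobenius permutation of the points and of its versions weighted by values of a
  polynomial.
\<close>
definition weighted_map_mat :: "'b set \<Rightarrow> ('b \<Rightarrow> 'b) \<Rightarrow> ('b \<Rightarrow> 'a::comm_ring_1) \<Rightarrow> 'a mat" where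
  "weighted_map_mat A \<phi> w = mat_on A (\<lambda>y x. of_bool (y = \<phi> x) * w x)"

text \<open>
  Only the points fixed by \<open>\<phi>^k\<close> contribute to the diagonal of the \<open>k\<close>-th power, each with the
  product of the weights along its orbit.
\<close>
lemma mat_trace_weighted_map_power:
  assumes A: "finite A" and \<phi>: "\<And>a. a \<in> A \<Longrightarrow> \<phi> a \<in> A"
  shows "mat_trace (weighted_map_mat A \<phi> w ^\<^sub>m k) =
    (\<Sum>x\<in>{x\<in>A. (\<phi> ^^ k) x = x}. \<Prod>j<k. w ((\<phi> ^^ j) x))"
proof -
  have it: "(\<phi> ^^ k) a \<in> A" if "a \<in> A" for k a
    using that \<phi> by (induction k) auto
  have "weighted_map_mat A \<phi> w ^\<^sub>m k = mat_on A (\<lambda>y x. of_bool (y = (\<phi> ^^ k) x) * (\<Prod>j<k. w ((\<phi> ^^ j) x)))"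
    unfolding weighted_map_mat_def
  proof (rule mat_on_power[OF A])
    fix k a b assume "a \<in> A" "b \<in> A"
    have "(\<Sum>c\<in>A. of_bool (a = \<phi> c) * w c * (of_bool (c = (\<phi> ^^ k) b) * (\<Prod>j<k. w ((\<phi> ^^ j) b))))
       = (\<Sum>c\<in>A. if c = (\<phi> ^^ k) b then of_bool (a = \<phi> c) * w c * (\<Prod>j<k. w ((\<phi> ^^ j) b)) else 0)"
      by (intro sum.cong) auto
    also have "\<dots> = of_bool (a = (\<phi> ^^ Suc k) b) * (\<Prod>j<Suc k. w ((\<phi> ^^ j) b))"
      using A it[OF \<open>b \<in> A\<close>, of k] by (simp add: mult_ac)
    finally show "of_bool (a = (\<phi> ^^ Suc k) b) * (\<Prod>j<Suc k. w ((\<phi> ^^ j) b))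
       = (\<Sum>c\<in>A. of_bool (a = \<phi> c) * w c * (of_bool (c = (\<phi> ^^ k) b) * (\<Prod>j<k. w ((\<phi> ^^ j) b))))" ..
  qed auto
  hence "mat_trace (weighted_map_mat A \<phi> w ^\<^sub>m k)
      = (\<Sum>x\<in>A. of_bool (x = (\<phi> ^^ k) x) * (\<Prod>j<k. w ((\<phi> ^^ j) x)))"
    using A by (simp add: mat_trace_mat_on)
  also have "\<dots> = (\<Sum>x\<in>{x\<in>A. (\<phi> ^^ k) x = x}. \<Prod>j<k. w ((\<phi> ^^ j) x))"
    using A by (intro sum.mono_neutral_cong_right) auto
  finally show ?thesis .
qed

text \<open>
  The relation says that \<open>w'\<close> and \<open>w\<close> differ by the coboundary of \<open>\<delta>\<close>, so that the diagonal matrix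
  with entries \<open>\<delta>\<close> conjugates one operator to the other.
\<close>
lemma det_weighted_map_coboundary:
  fixes w w' \<delta> :: "'b \<Rightarrow> 'a::field"
  assumes A: "finite A" and \<delta>: "\<And>x. x \<in> A \<Longrightarrow> \<delta> x \<noteq> 0"
    and eq: "\<And>x. x \<in> A \<Longrightarrow> w' x * \<delta> x = \<delta> (\<phi> x) * w x"
  shows "det_one_minus_X (weighted_map_mat A \<phi> w') = det_one_minus_X (weighted_map_mat A \<phi> w)"
proof (rule det_one_minus_X_similar, rule similar_matI)
  let ?P = "mat_on A (\<lambda>y x. of_bool (y = x) * \<delta> x)" and ?Q = "mat_on A (\<lambda>y x. of_bool (y = x) * inverse (\<delta> x))"
  have diag: "(\<Sum>c\<in>A. of_bool (a = c) * h c * h' c) = h a * (h' a :: 'a)" if "a \<in> A" for a h h'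
  proof -
    have "(\<Sum>c\<in>A. of_bool (a = c) * h c * h' c) = (\<Sum>c\<in>A. if a = c then h c * h' c else 0)"
      by (intro sum.cong) auto
    also have "\<dots> = h a * h' a" using A that by (subst sum.delta') auto
    finally show ?thesis .
  qed
  have diag': "(\<Sum>c\<in>A. h' c * (of_bool (c = a) * t)) = h' a * (t :: 'a)" if "a \<in> A" for a t h'
  proof -
    have "(\<Sum>c\<in>A. h' c * (of_bool (c = a) * t)) = (\<Sum>c\<in>A. if c = a then h' c * t else 0)"
      by (intro sum.cong) auto
    also have "\<dots> = h' a * t" using A that by (subst sum.delta) auto
    finally show ?thesis .
  qed
  show "{weighted_map_mat A \<phi> w', weighted_map_mat A \<phi> w, ?P, ?Q} \<subseteq> carrier_mat (card A) (card A)"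
    by (simp add: weighted_map_mat_def)
  show "?P * ?Q = 1\<^sub>m (card A)" "?Q * ?P = 1\<^sub>m (card A)"
    unfolding mat_on_mult[OF A] mat_on_1[OF A, symmetric]
    using \<delta> by (auto intro!: mat_on_cong[OF A] simp: diag)
  show "weighted_map_mat A \<phi> w' = ?P * weighted_map_mat A \<phi> w * ?Q"
    unfolding weighted_map_mat_def mat_on_mult[OF A]
  proof (rule mat_on_cong[OF A])
    fix a b assume ab: "a \<in> A" "b \<in> A"
    have "(\<Sum>c\<in>A. (\<Sum>ca\<in>A. of_bool (a = ca) * \<delta> ca * (of_bool (ca = \<phi> c) * w c)) * (of_bool (c = b) * inverse (\<delta> b)))
        = \<delta> a * (of_bool (a = \<phi> b) * w b) * inverse (\<delta> b)"
      using ab by (simp only: diag diag')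
    also have "\<dots> = of_bool (a = \<phi> b) * (\<delta> (\<phi> b) * w b) * inverse (\<delta> b)" by simp
    also have "\<delta> (\<phi> b) * w b = w' b * \<delta> b" using eq[OF ab(2)] ..
    also have "of_bool (a = \<phi> b) * (w' b * \<delta> b) * inverse (\<delta> b) = of_bool (a = \<phi> b) * w' b"
      using \<delta>[OF ab(2)] by simp
    finally show "of_bool (a = \<phi> b) * w' b =
       (\<Sum>c\<in>A. (\<Sum>ca\<in>A. of_bool (a = ca) * \<delta> ca * (of_bool (ca = \<phi> c) * w c)) * (of_bool (c = b) * inverse (\<delta> b)))" ..
  qed
qed

section \<open>Traces of powers of the Dwork operator\<close>

text \<open>
  With \<open>G = \<Sum>\<^sub>e\<^sub>\<in>\<^sub>S c e x^e\<close>, this is the value of the linear functional \<open>x^t \<mapsto> h t\<close> at the polynomial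
  \<open>G(x) G(x^q) \<dots> G(x^(q^(k-1)))\<close>, see \<open>prod_eq_word_sum\<close>. Both sides of the trace formula are
  values of such functionals, so that they can be compared term by term, without ever
  expanding the product.
\<close>
fun word_sum :: "nat \<Rightarrow> ('n \<Rightarrow> nat) set \<Rightarrow> (('n \<Rightarrow> nat) \<Rightarrow> 'a::comm_ring_1) \<Rightarrow> nat \<Rightarrow> (('n \<Rightarrow> nat) \<Rightarrow> 'a) \<Rightarrow> 'a" where
  "word_sum q S c 0 h = h (\<lambda>_. 0)"
| "word_sum q S c (Suc k) h = (\<Sum>e\<in>S. c e * word_sum q S c k (\<lambda>t. h (\<lambda>i. t i + q ^ k * e i)))"

lemma word_sum_sum: "word_sum q S c k (\<lambda>t. \<Sum>a\<in>A. h a t) = (\<Sum>a\<in>A. word_sum q S c k (h a))"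
proof (induction k arbitrary: h)
  case (Suc k)
  have "word_sum q S c (Suc k) (\<lambda>t. \<Sum>a\<in>A. h a t) =
      (\<Sum>e\<in>S. \<Sum>a\<in>A. c e * word_sum q S c k (\<lambda>t. h a (\<lambda>i. t i + q ^ k * e i)))"
    by (simp add: Suc sum_distrib_left)
  also have "\<dots> = (\<Sum>a\<in>A. word_sum q S c (Suc k) (h a))"
    by (subst sum.swap) simp
  finally show ?case .
qed auto

lemma word_sum_mult: "word_sum q S c k (\<lambda>t. b * h t) = b * word_sum q S c k h"
proof (induction k arbitrary: h)
  case (Suc k)
  show ?case by (simp add: Suc sum_distrib_left mult.left_commute)
qed auto

lemma word_sum_mult_right: "word_sum q S c k (\<lambda>t. h t * b) = word_sum q S c k h * b"
  using word_sum_mult[of q S c k b h] by (simp add: mult.commute)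

text \<open>
  If \<open>G\<close> has degree at most \<open>d (q - 1)\<close>, then the product of \<open>k\<close> twisted copies has degree at most
  \<open>d (q - 1) (1 + q + \<dots> + q^(k-1)) = d (q^k - 1)\<close>.
\<close>
lemma word_sum_cong:
  fixes S :: "('n::finite \<Rightarrow> nat) set"
  assumes S: "\<And>e. e \<in> S \<Longrightarrow> (\<Sum>i\<in>UNIV. e i) \<le> d * (q - 1)" and q: "q \<ge> 1"
    and h: "\<And>t. (\<Sum>i\<in>UNIV. t i) \<le> d * (q ^ k - 1) \<Longrightarrow> h t = h' t"
  shows "word_sum q S c k h = word_sum q S c k h'"
  using h
proof (induction k arbitrary: h h')
  case (Suc k)
  have "word_sum q S c k (\<lambda>t. h (\<lambda>i. t i + q ^ k * e i)) = word_sum q S c k (\<lambda>t. h' (\<lambda>i. t i + q ^ k * e i))"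
    if e: "e \<in> S" for e
  proof (rule Suc.IH, rule Suc.prems)
    fix t :: "'n \<Rightarrow> nat" assume t: "sum t UNIV \<le> d * (q ^ k - 1)"
    have "(\<Sum>i\<in>UNIV. t i + q ^ k * e i) = sum t UNIV + q ^ k * sum e UNIV"
      by (simp add: sum.distrib sum_distrib_left)
    also have "\<dots> \<le> d * (q ^ k - 1) + q ^ k * (d * (q - 1))"
      using t S[OF e] by (intro add_mono mult_left_mono) auto
    also have "\<dots> = d * (q ^ Suc k - 1)"
      using q by (simp add: algebra_simps diff_mult_distrib2)
    finally show "(\<Sum>i\<in>UNIV. t i + q ^ k * e i) \<le> d * (q ^ Suc k - 1)" .
  qed
  thus ?case by simp
qed auto

lemma prod_eq_word_sum:
  fixes x :: "'n::finite \<Rightarrow> 'a::comm_ring_1"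
  shows "(\<Prod>j<k. \<Sum>e\<in>S. c e * (\<Prod>i\<in>UNIV. (x i ^ (q ^ j)) ^ e i)) = word_sum q S c k (\<lambda>t. \<Prod>i\<in>UNIV. x i ^ t i)"
proof (induction k)
  case (Suc k)
  have "word_sum q S c (Suc k) (\<lambda>t. \<Prod>i\<in>UNIV. x i ^ t i)
     = (\<Sum>e\<in>S. c e * word_sum q S c k (\<lambda>t. (\<Prod>i\<in>UNIV. x i ^ t i) * (\<Prod>i\<in>UNIV. (x i ^ (q ^ k)) ^ e i)))"
    by (simp add: power_add power_mult prod.distrib)
  also have "\<dots> = word_sum q S c k (\<lambda>t. (\<Prod>i\<in>UNIV. x i ^ t i)) * (\<Sum>e\<in>S. c e * (\<Prod>i\<in>UNIV. (x i ^ (q ^ k)) ^ e i))"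
    by (simp add: word_sum_mult_right sum_distrib_left mult.left_commute)
  finally show ?case using Suc by simp
qed auto

text \<open>
  For \<open>I = UNIV\<close> these are the exponents of the monomials that span the space of the theorem. The
  other sets \<open>I\<close> come from points with some coordinates equal to zero.
\<close>
definition exponent_box :: "nat \<Rightarrow> 'n::finite set \<Rightarrow> ('n \<Rightarrow> nat) set" where
  "exponent_box d I = {v. (\<Sum>i\<in>UNIV. v i) \<le> d \<and> (\<forall>i\<in>I. v i > 0)}"

lemma finite_exponent_box: "finite (exponent_box d I)"
proof (rule finite_subset)
  show "exponent_box d I \<subseteq> PiE UNIV (\<lambda>_. {..d})"
  proof
    fix v :: "'a \<Rightarrow> nat" assume "v \<in> exponent_box d I"
    hence "sum v UNIV \<le> d" by (simp add: exponent_box_def)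
    moreover have "v i \<le> sum v UNIV" for i by (rule member_le_sum) auto
    ultimately show "v \<in> PiE UNIV (\<lambda>_. {..d})" by (auto intro: order_trans)
  qed
qed (auto intro: finite_PiE)

text \<open>
  The coefficient of \<open>x^v\<close> in \<open>\<psi>\<^sub>q (G x^u)\<close>.
\<close>
definition dwork_entry :: "nat \<Rightarrow> ('n \<Rightarrow> nat) set \<Rightarrow> (('n \<Rightarrow> nat) \<Rightarrow> 'a::comm_ring_1) \<Rightarrow> ('n \<Rightarrow> nat) \<Rightarrow> ('n \<Rightarrow> nat) \<Rightarrow> 'a" where
  "dwork_entry q S c v u = (\<Sum>e\<in>S. c e * of_bool (\<forall>i. q * v i = e i + u i))"

text \<open>
  This is \<open>(\<psi>\<^sub>q \<circ> G)^k = \<psi>\<^bsub>q^k\<^esub> \<circ> G(x) G(x^q) \<dots> G(x^(q^(k-1)))\<close> on the level of matrix entries. The point is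
  that an intermediate exponent \<open>w\<close> with \<open>q v = e + w\<close> lies in the box again: it is bounded by
  the degree estimate of \<open>word_sum_cong\<close>, and it is positive where \<open>u\<close> is, because
  \<open>q^k w = t + u\<close>.
\<close>
lemma dwork_mat_power:
  fixes S :: "('n::finite \<Rightarrow> nat) set" and c :: "('n \<Rightarrow> nat) \<Rightarrow> 'a::comm_ring_1"
  assumes S: "\<And>e. e \<in> S \<Longrightarrow> (\<Sum>i\<in>UNIV. e i) \<le> d * (q - 1)" and q: "q \<ge> 1"
  shows "mat_on (exponent_box d I) (\<lambda>v u. b * dwork_entry q S c v u) ^\<^sub>m k =
    mat_on (exponent_box d I) (\<lambda>v u. b ^ k * word_sum q S c k (\<lambda>t. of_bool (\<forall>i. q ^ k * v i = t i + u i)))"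
proof (rule mat_on_power[OF finite_exponent_box], goal_cases)
  case (1 v u)
  show ?case by (auto simp: fun_eq_iff)
next
  case (2 k v u)
  let ?\<Omega> = "exponent_box d I"
  have *: "(\<Sum>w\<in>?\<Omega>. of_bool (\<forall>i. q * v i = e i + w i) * word_sum q S c k (\<lambda>t. of_bool (\<forall>i. q ^ k * w i = t i + u i)))
     = word_sum q S c k (\<lambda>t. of_bool (\<forall>i. q ^ Suc k * v i = t i + q ^ k * e i + u i))" if e: "e \<in> S" for e
  proof -
    have "(\<Sum>w\<in>?\<Omega>. of_bool (\<forall>i. q * v i = e i + w i) * word_sum q S c k (\<lambda>t. of_bool (\<forall>i. q ^ k * w i = t i + u i)))
      = word_sum q S c k (\<lambda>t. \<Sum>w\<in>?\<Omega>. of_bool (\<forall>i. q * v i = e i + w i) * of_bool (\<forall>i. q ^ k * w i = t i + u i))"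
      by (simp add: word_sum_sum word_sum_mult)
    also have "\<dots> = word_sum q S c k (\<lambda>t. of_bool (\<forall>i. q ^ Suc k * v i = t i + q ^ k * e i + u i))"
    proof (rule word_sum_cong[OF S q])
      fix t :: "'n \<Rightarrow> nat" assume t: "sum t UNIV \<le> d * (q ^ k - 1)"
      define w where "w i = q * v i - e i" for i
      have qk: "q ^ k > 0" using q by simp
      show "(\<Sum>w\<in>?\<Omega>. of_bool (\<forall>i. q * v i = e i + w i) * of_bool (\<forall>i. q ^ k * w i = t i + u i)) =
         (of_bool (\<forall>i. q ^ Suc k * v i = t i + q ^ k * e i + u i) :: 'a)"
      proof (cases "\<forall>i. q ^ Suc k * v i = t i + q ^ k * e i + u i")
        case True
        have le: "q * v i \<ge> e i" for i
        proof -
          have "q ^ k * e i \<le> q ^ k * (q * v i)" using True[rule_format, of i] by (simp add: mult_ac)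
          thus ?thesis using qk by (rule mult_left_le_imp_le)
        qed
        have w1: "q * v i = e i + w i" for i using le[of i] by (simp add: w_def)
        have w2: "q ^ k * w i = t i + u i" for i
        proof -
          have "q ^ Suc k * v i = q ^ k * (q * v i)" by simp
          also have "\<dots> = q ^ k * e i + q ^ k * w i" unfolding w1[of i] by (rule distrib_left)
          finally show ?thesis using True[rule_format, of i] by linarith
        qed
        have "q ^ k * sum w UNIV = sum t UNIV + sum u UNIV"
          by (simp add: sum_distrib_left w2 sum.distrib)
        also have "\<dots> \<le> d * (q ^ k - 1) + d"
          using t 2 by (intro add_mono) (auto simp: exponent_box_def)
        also have "\<dots> = q ^ k * d"
          using qk by (cases "q ^ k") (simp_all add: algebra_simps)
        finally have "sum w UNIV \<le> d" using qk by (rule mult_left_le_imp_le)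
        moreover have "w i > 0" if "i \<in> I" for i
        proof -
          have "u i > 0" using 2 that by (auto simp: exponent_box_def)
          thus ?thesis using w2[of i] by (cases "w i = 0") auto
        qed
        ultimately have w: "w \<in> ?\<Omega>" by (simp add: exponent_box_def)
        have "(\<forall>i. q * v i = e i + x i) \<and> (\<forall>i. q ^ k * x i = t i + u i) \<longleftrightarrow> x = w" for x
          using w1 w2 by (auto simp: fun_eq_iff)
        hence "(\<Sum>x\<in>?\<Omega>. of_bool (\<forall>i. q * v i = e i + x i) * of_bool (\<forall>i. q ^ k * x i = t i + u i))
           = (\<Sum>x\<in>?\<Omega>. if x = w then 1 else (0 :: 'a))"
          unfolding of_bool_conj[symmetric] by (intro sum.cong) auto
        also have "\<dots> = 1"
          using w by (simp only: sum.delta finite_exponent_box if_True)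
        finally have "(\<Sum>x\<in>?\<Omega>. of_bool (\<forall>i. q * v i = e i + x i) * of_bool (\<forall>i. q ^ k * x i = t i + u i)) = (1 :: 'a)" .
        thus ?thesis using True by simp
      next
        case False
        have "of_bool (\<forall>i. q * v i = e i + x i) * of_bool (\<forall>i. q ^ k * x i = t i + u i) = (0 :: 'a)" for x
        proof -
          have False if "\<And>i. q * v i = e i + x i" "\<And>i. q ^ k * x i = t i + u i"
          proof -
            have "q ^ Suc k * v i = t i + q ^ k * e i + u i" for i
            proof -
              have "q ^ Suc k * v i = q ^ k * (q * v i)" by simp
              also have "\<dots> = q ^ k * e i + q ^ k * x i" by (simp only: that(1) distrib_left)
              finally show ?thesis using that(2)[of i] by simp
            qed
            thus False using False by blast
          qed
          thus ?thesis by auto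
        qed
        thus ?thesis using False by simp
      qed
    qed
    finally show ?thesis .
  qed
  have "(\<Sum>w\<in>?\<Omega>. b * dwork_entry q S c v w * (b ^ k * word_sum q S c k (\<lambda>t. of_bool (\<forall>i. q ^ k * w i = t i + u i))))
    = b ^ Suc k * (\<Sum>w\<in>?\<Omega>. \<Sum>e\<in>S. c e * (of_bool (\<forall>i. q * v i = e i + w i) * word_sum q S c k (\<lambda>t. of_bool (\<forall>i. q ^ k * w i = t i + u i))))"
    unfolding dwork_entry_def sum_distrib_left sum_distrib_right by (intro sum.cong refl) (simp add: mult_ac)
  also have "(\<Sum>w\<in>?\<Omega>. \<Sum>e\<in>S. c e * (of_bool (\<forall>i. q * v i = e i + w i) * word_sum q S c k (\<lambda>t. of_bool (\<forall>i. q ^ k * w i = t i + u i))))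
    = (\<Sum>e\<in>S. c e * (\<Sum>w\<in>?\<Omega>. of_bool (\<forall>i. q * v i = e i + w i) * word_sum q S c k (\<lambda>t. of_bool (\<forall>i. q ^ k * w i = t i + u i))))"
    unfolding sum_distrib_left by (rule sum.swap)
  also have "\<dots> = (\<Sum>e\<in>S. c e * word_sum q S c k (\<lambda>t. of_bool (\<forall>i. q ^ Suc k * v i = t i + q ^ k * e i + u i)))"
    by (intro sum.cong refl arg_cong2[of _ _ _ _ "(*)"] *)
  finally show ?case by simp
qed

text \<open>
  On the diagonal, the exponent \<open>t\<close> has to be \<open>(q^k - 1) v\<close> with \<open>v\<close> in the box. The degree bound on
  \<open>v\<close> follows from that on \<open>t\<close>, which leaves divisibility and positivity.
\<close>
lemma trace_dwork_mat_power:
  fixes S :: "('n::finite \<Rightarrow> nat) set" and c :: "('n \<Rightarrow> nat) \<Rightarrow> 'a::comm_ring_1"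
  assumes S: "\<And>e. e \<in> S \<Longrightarrow> (\<Sum>i\<in>UNIV. e i) \<le> d * (q - 1)" and q: "q \<ge> 2" and k: "k \<ge> 1"
  shows "mat_trace (mat_on (exponent_box d I) (\<lambda>v u. b * dwork_entry q S c v u) ^\<^sub>m k) =
    b ^ k * word_sum q S c k (\<lambda>t. of_bool (\<forall>i. (q ^ k - 1) dvd t i \<and> (i \<in> I \<longrightarrow> t i > 0)))"
proof -
  let ?\<Omega> = "exponent_box d I"
  have qk: "q ^ k > 1" using q k by (intro one_less_power) auto
  have "mat_trace (mat_on ?\<Omega> (\<lambda>v u. b * dwork_entry q S c v u) ^\<^sub>m k) =
     b ^ k * word_sum q S c k (\<lambda>t. \<Sum>v\<in>?\<Omega>. of_bool (\<forall>i. q ^ k * v i = t i + v i))"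
    using q by (subst dwork_mat_power[OF S])
      (simp_all add: mat_trace_mat_on finite_exponent_box word_sum_sum sum_distrib_left del: sum_of_bool_eq)
  also have "word_sum q S c k (\<lambda>t. \<Sum>v\<in>?\<Omega>. of_bool (\<forall>i. q ^ k * v i = t i + v i)) =
     word_sum q S c k (\<lambda>t. of_bool (\<forall>i. (q ^ k - 1) dvd t i \<and> (i \<in> I \<longrightarrow> t i > 0)))"
  proof (rule word_sum_cong[OF S])
    fix t :: "'n \<Rightarrow> nat" assume t: "sum t UNIV \<le> d * (q ^ k - 1)"
    have eq: "q ^ k * a = s + a \<longleftrightarrow> s = (q ^ k - 1) * a" for s a :: nat
      using qk by (auto simp: diff_mult_distrib)
    show "(\<Sum>v\<in>?\<Omega>. of_bool (\<forall>i. q ^ k * v i = t i + v i)) =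
       (of_bool (\<forall>i. (q ^ k - 1) dvd t i \<and> (i \<in> I \<longrightarrow> t i > 0)) :: 'a)"
    proof (cases "\<forall>i. (q ^ k - 1) dvd t i \<and> (i \<in> I \<longrightarrow> t i > 0)")
      case True
      define v where "v i = t i div (q ^ k - 1)" for i
      have v: "t i = (q ^ k - 1) * v i" for i using True by (simp add: v_def)
      have "sum v UNIV \<le> d"
      proof (rule mult_left_le_imp_le)
        have "(q ^ k - 1) * sum v UNIV = sum t UNIV"
          unfolding sum_distrib_left by (rule sum.cong) (simp_all only: v)
        also have "\<dots> \<le> d * (q ^ k - 1)" by (fact t)
        also have "\<dots> = (q ^ k - 1) * d" by (rule mult.commute)
        finally show "(q ^ k - 1) * sum v UNIV \<le> (q ^ k - 1) * d" .
        show "0 < q ^ k - 1" using qk by linarith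
      qed
      moreover have "v i > 0" if "i \<in> I" for i
        using True[rule_format, of i] that v[of i] by (cases "v i = 0") auto
      ultimately have "v \<in> ?\<Omega>" by (simp add: exponent_box_def)
      have "(\<forall>i. q ^ k * x i = t i + x i) \<longleftrightarrow> x = v" for x
      proof -
        have "q ^ k - 1 \<noteq> 0" using qk by linarith
        hence "t i = (q ^ k - 1) * x i \<longleftrightarrow> v i = x i" for i
          unfolding v[of i] by (metis mult_cancel_left)
        thus ?thesis unfolding eq fun_eq_iff by auto
      qed
      hence "(\<Sum>x\<in>?\<Omega>. of_bool (\<forall>i. q ^ k * x i = t i + x i)) = (\<Sum>x\<in>?\<Omega>. if x = v then 1 else (0 :: 'a))"
        by (intro sum.cong) auto
      also have "\<dots> = 1"
        using \<open>v \<in> ?\<Omega>\<close> by (simp only: sum.delta finite_exponent_box if_True)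
      also have "\<dots> = of_bool (\<forall>i. (q ^ k - 1) dvd t i \<and> (i \<in> I \<longrightarrow> t i > 0))"
        using True by (subst of_bool_eq_1_iff[THEN iffD2]) auto
      finally show ?thesis .
    next
      case False
      have "of_bool (\<forall>i. q ^ k * v i = t i + v i) = (0 :: 'a)" if "v \<in> ?\<Omega>" for v
      proof -
        have False if "\<forall>i. t i = (q ^ k - 1) * v i"
        proof -
          have "(q ^ k - 1) dvd t i \<and> (i \<in> I \<longrightarrow> t i > 0)" for i
            using that[rule_format, of i] \<open>v \<in> ?\<Omega>\<close> qk by (auto simp: exponent_box_def)
          with False show False by blast
        qed
        thus ?thesis unfolding eq by auto
      qed
      hence "(\<Sum>v\<in>?\<Omega>. of_bool (\<forall>i. q ^ k * v i = t i + v i)) = (0 :: 'a)"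
        by (intro sum.neutral) blast
      also have "\<dots> = of_bool (\<forall>i. (q ^ k - 1) dvd t i \<and> (i \<in> I \<longrightarrow> t i > 0))"
        using False by (subst of_bool_eq_0_iff[THEN iffD2]) auto
      finally show ?thesis .
    qed
  qed (use q in auto)
  finally show ?thesis .
qed

section \<open>The trace formula over roots of unity\<close>

text \<open>
  The elements of the field with \<open>N + 1 = q^K\<close> elements are encoded by \<open>0, \<dots>, N\<close>: a number \<open>j < N\<close>
  stands for \<open>z^j\<close>, where \<open>z\<close> is a generator or a lift of it, and \<open>N\<close> stands for zero. The encoding does
  not depend on the ring that contains \<open>z\<close>, so the same index set serves all rings.
\<close>
definition teich :: "nat \<Rightarrow> 'a::comm_ring_1 \<Rightarrow> nat \<Rightarrow> 'a" where
  "teich N z j = (if j < N then z ^ j else 0)"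

text \<open>
  The Frobenius map \<open>x \<mapsto> x^q\<close> in terms of this encoding.
\<close>
definition frob :: "nat \<Rightarrow> nat \<Rightarrow> nat \<Rightarrow> nat" where
  "frob N q j = (if j < N then (q * j) mod N else j)"

definition teich_points :: "nat \<Rightarrow> ('n \<Rightarrow> nat) set" where
  "teich_points N = UNIV \<rightarrow>\<^sub>E {..N}"

lemma finite_teich_points: "finite (teich_points N :: ('n::finite \<Rightarrow> nat) set)"
  unfolding teich_points_def by (intro finite_PiE) auto

lemma frob_le: "j \<le> N \<Longrightarrow> frob N q j \<le> N"
  by (cases "j < N") (auto simp: frob_def intro: less_imp_le mod_less_divisor)

lemma frob_teich_points: "x \<in> teich_points N \<Longrightarrow> frob N q \<circ> x \<in> teich_points N"
  by (auto simp: teich_points_def PiE_iff frob_le)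

lemma frob_power: "(frob N q ^^ k) j = (if j < N then (q ^ k * j) mod N else j)"
proof (induction k)
  case (Suc k)
  have "q * (q ^ k * j mod N) mod N = q ^ Suc k * j mod N"
    by (simp add: mod_mult_right_eq mult.assoc)
  thus ?case using Suc mod_less_divisor[of N "q ^ k * j"] by (auto simp: frob_def)
qed auto

lemma comp_frob_power: "(((\<circ>) (frob N q)) ^^ k) x = (frob N q ^^ k) \<circ> x"
  by (induction k) (auto simp: fun_eq_iff)

lemma teich_frob_power:
  assumes "z ^ N = 1" "q > 0"
  shows "teich N z ((frob N q ^^ k) j) = teich N z j ^ (q ^ k)"
proof (cases "j < N")
  case True
  have "z ^ (q ^ k * j) = z ^ (N * (q ^ k * j div N) + q ^ k * j mod N)" by simp
  also have "\<dots> = z ^ (q ^ k * j mod N)"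
    using assms unfolding power_add power_mult by simp
  finally show ?thesis using True mod_less_divisor[of N "q ^ k * j"]
    by (simp add: frob_power teich_def power_mult[symmetric] mult.commute)
next
  case False
  thus ?thesis using assms by (simp add: frob_power teich_def zero_power)
qed

lemma power_minus_1_dvd:
  assumes "k dvd K" and q: "q \<ge> (1::nat)"
  shows "q ^ k - 1 dvd q ^ K - 1"
proof -
  from assms obtain m where m: "K = k * m" by (auto elim: dvdE)
  have "(q ^ k - 1) dvd (q ^ k) ^ m - 1" for m
  proof (induction m)
    case (Suc m)
    have "(q ^ k) ^ m \<ge> 1" "q ^ k \<ge> 1" using q by simp_all
    hence "(q ^ k) ^ Suc m - 1 = q ^ k * ((q ^ k) ^ m - 1) + (q ^ k - 1)"
      by (simp add: diff_mult_distrib2)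
    thus ?case using Suc by simp
  qed auto
  thus ?thesis by (simp add: m power_mult)
qed

text \<open>
  The nonzero fixed points of the \<open>k\<close>-th power of Frobenius are the \<open>(q^k - 1)\<close>-th roots of unity. By
  orthogonality their \<open>t\<close>-th powers add up to \<open>q^k - 1\<close> or to \<open>0\<close>, and the point zero adds \<open>1\<close> if
  \<open>t = 0\<close>. The form of the right-hand side makes the product over all coordinates expand into the
  alternating sum of \<open>trace_teich_mat_power\<close>.
\<close>
lemma sum_teich_power:
  fixes z :: "'a::idom"
  assumes z: "primitive_root N z" and N: "N = q ^ K - 1" and K: "K \<ge> 1" and q: "q \<ge> 2" and k: "k \<ge> 1" "k dvd K"
  shows "(\<Sum>j\<in>{j. j \<le> N \<and> (frob N q ^^ k) j = j}. teich N z j ^ t) =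
    of_bool ((q ^ k - 1) dvd t) * (of_nat (q ^ k) - of_bool (t > 0))"
proof -
  define M where "M = q ^ k - 1"
  have qK: "q ^ K > 1" using K q by (intro one_less_power) auto
  have qk: "q ^ k > 1" using k q by (intro one_less_power) auto
  have "N > 0" using N qK by simp
  have "M > 0" using qk by (simp add: M_def)
  obtain L where L: "N = M * L"
    using power_minus_1_dvd[OF k(2), of q] q by (auto simp: N M_def elim: dvdE)
  have "L > 0" using L \<open>N > 0\<close> by (cases L) auto
  have fixed: "(frob N q ^^ k) j = j \<longleftrightarrow> L dvd j" if "j < N" for j
  proof -
    have "(frob N q ^^ k) j = j \<longleftrightarrow> (M * j + j) mod N = j mod N"
      using that qk by (simp add: frob_power M_def diff_mult_distrib)
    also have "\<dots> \<longleftrightarrow> N dvd M * j"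
      using mod_eq_dvd_iff_nat[of j "M * j + j" N] by simp
    also have "\<dots> \<longleftrightarrow> L dvd j"
      using \<open>M > 0\<close> by (simp add: L)
    finally show ?thesis .
  qed
  have set: "{j. j \<le> N \<and> (frob N q ^^ k) j = j} = insert N ((\<lambda>l. L * l) ` {..<M})"
  proof (intro equalityI subsetI)
    fix j assume j: "j \<in> {j. j \<le> N \<and> (frob N q ^^ k) j = j}"
    show "j \<in> insert N ((\<lambda>l. L * l) ` {..<M})"
    proof (cases "j = N")
      case False
      hence "j < N" "L dvd j" using j fixed[of j] by auto
      then obtain l where "j = L * l" "l < M" using \<open>L > 0\<close> by (auto simp: L mult.commute)
      thus ?thesis by auto
    qed auto
  next
    fix j assume "j \<in> insert N ((\<lambda>l. L * l) ` {..<M})"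
    thus "j \<in> {j. j \<le> N \<and> (frob N q ^^ k) j = j}"
    proof
      assume "j \<in> (\<lambda>l. L * l) ` {..<M}"
      then obtain l where l: "j = L * l" "l < M" by auto
      hence "j < N" using \<open>L > 0\<close> by (simp add: L mult.commute)
      thus ?thesis using fixed[of j] l by simp
    qed (simp add: frob_power)
  qed
  have notin: "N \<notin> (\<lambda>l. L * l) ` {..<M}"
    using \<open>L > 0\<close> by (auto simp: L mult.commute)
  define y where "y = z ^ (L * t)"
  have yM: "y ^ M = 1"
    using z L by (simp add: y_def primitive_root_def power_mult[symmetric] mult_ac)
      (metis mult.commute power_mult power_one)
  have y1: "y = 1 \<longleftrightarrow> M dvd t"
    using primitive_root_power_eq_1_iff[OF z \<open>N > 0\<close>, of "L * t"] \<open>L > 0\<close> by (simp add: y_def L mult.commute)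
  have "(\<Sum>j\<in>{j. j \<le> N \<and> (frob N q ^^ k) j = j}. teich N z j ^ t) = 0 ^ t + (\<Sum>j\<in>(\<lambda>l. L * l) ` {..<M}. teich N z j ^ t)"
    unfolding set using notin by (simp add: teich_def)
  also have "(\<Sum>j\<in>(\<lambda>l. L * l) ` {..<M}. teich N z j ^ t) = (\<Sum>l<M. teich N z (L * l) ^ t)"
    using \<open>L > 0\<close> by (subst sum.reindex) (auto simp: inj_on_def)
  also have "\<dots> = (\<Sum>l<M. y ^ l)"
    using \<open>L > 0\<close> by (intro sum.cong refl) (auto simp: teich_def y_def L power_mult[symmetric] mult_ac)
  also have "\<dots> = of_bool (M dvd t) * of_nat M"
  proof (cases "M dvd t")
    case False
    hence "y - 1 \<noteq> 0" using y1 by simp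
    moreover have "(y - 1) * (\<Sum>l<M. y ^ l) = 0" using power_diff_1_eq[of y M] yM by simp
    ultimately show ?thesis using False by simp
  qed (use y1 in simp)
  also have "0 ^ t + of_bool (M dvd t) * of_nat M = of_bool (M dvd t) * (of_nat (q ^ k) - of_bool (t > 0) :: 'a)"
  proof -
    have "of_nat (q ^ k) = (of_nat M + 1 :: 'a)"
      using qk by (simp add: M_def of_nat_diff)
    thus ?thesis by (cases "t = 0") auto
  qed
  finally show ?thesis by (simp add: M_def)
qed

definition teich_weight :: "nat \<Rightarrow> 'a::comm_ring_1 \<Rightarrow> ('n::finite \<Rightarrow> nat) set \<Rightarrow> (('n \<Rightarrow> nat) \<Rightarrow> 'a) \<Rightarrow> ('n \<Rightarrow> nat) \<Rightarrow> 'a" where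
  "teich_weight N z S c x = (\<Sum>e\<in>S. c e * (\<Prod>i\<in>UNIV. teich N z (x i) ^ e i))"

definition teich_mat :: "nat \<Rightarrow> nat \<Rightarrow> 'a::comm_ring_1 \<Rightarrow> ('n::finite \<Rightarrow> nat) set \<Rightarrow> (('n \<Rightarrow> nat) \<Rightarrow> 'a) \<Rightarrow> 'a mat" where
  "teich_mat N q z S c = weighted_map_mat (teich_points N) ((\<circ>) (frob N q)) (teich_weight N z S c)"

text \<open>
  The factor is the power of \<open>q\<close> with which the variables outside \<open>I\<close> enter the trace formula. Being
  part of the matrix, it becomes \<open>q^(k (n - card I))\<close> in the \<open>k\<close>-th power.
\<close>
definition dwork_mat :: "nat \<Rightarrow> 'n::finite set \<Rightarrow> nat \<Rightarrow> ('n \<Rightarrow> nat) set \<Rightarrow> (('n \<Rightarrow> nat) \<Rightarrow> 'a::comm_ring_1) \<Rightarrow> 'a mat" where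
  "dwork_mat d I q S c =
     mat_on (exponent_box d I) (\<lambda>v u. of_nat (q ^ (CARD('n) - card I)) * dwork_entry q S c v u)"

lemma teich_mat_carrier [simp]:
  "teich_mat N q z (S :: ('n::finite \<Rightarrow> nat) set) c
     \<in> carrier_mat (card (teich_points N :: ('n \<Rightarrow> nat) set)) (card (teich_points N :: ('n \<Rightarrow> nat) set))"
  by (simp add: teich_mat_def weighted_map_mat_def)

lemma dwork_mat_carrier [simp]:
  "dwork_mat d I q S c \<in> carrier_mat (card (exponent_box d I)) (card (exponent_box d I))"
  by (simp add: dwork_mat_def)

text \<open>
  Dwork's trace formula. The sum over the fixed points is taken inside the \<open>word_sum\<close>, where it
  factors over the coordinates and is given by \<open>sum_teich_power\<close>. Expanding
  \<open>\<Prod>\<^sub>i (q^k - [t\<^sub>i > 0])\<close> over the sets \<open>I\<close> of coordinates that contribute their second term gives the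
  alternating sum of the traces computed in \<open>trace_dwork_mat_power\<close>.
\<close>
lemma trace_teich_mat_power:
  fixes z :: "'a::idom" and S :: "('n::finite \<Rightarrow> nat) set"
  assumes z: "primitive_root N z" and N: "N = q ^ K - 1" and K: "K \<ge> 1" and q: "q \<ge> 2" and k: "k \<ge> 1" "k dvd K"
    and S: "\<And>e. e \<in> S \<Longrightarrow> (\<Sum>i\<in>UNIV. e i) \<le> d * (q - 1)"
  shows "mat_trace (teich_mat N q z S c ^\<^sub>m k) =
     (\<Sum>I\<in>Pow UNIV. (-1) ^ card I * mat_trace (dwork_mat d I q S c ^\<^sub>m k))"
proof -
  let ?M = "q ^ k - 1"
  let ?fix = "{j. j \<le> N \<and> (frob N q ^^ k) j = j}"
  have qk: "q ^ k > 1" using k q by (intro one_less_power) auto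
  have zN: "z ^ N = 1" using z by (simp add: primitive_root_def)
  have fixset: "{x \<in> teich_points N. (((\<circ>) (frob N q)) ^^ k) x = x} = (UNIV \<rightarrow>\<^sub>E ?fix :: ('n \<Rightarrow> nat) set)"
    by (auto simp: teich_points_def comp_frob_power fun_eq_iff PiE_iff)
  have "mat_trace (teich_mat N q z S c ^\<^sub>m k) =
      (\<Sum>x\<in>UNIV \<rightarrow>\<^sub>E ?fix. \<Prod>j<k. teich_weight N z S c ((((\<circ>) (frob N q)) ^^ j) x))"
    unfolding teich_mat_def fixset[symmetric]
    by (intro mat_trace_weighted_map_power finite_teich_points frob_teich_points)
  also have "\<dots> = (\<Sum>x\<in>UNIV \<rightarrow>\<^sub>E ?fix. word_sum q S c k (\<lambda>t. \<Prod>i\<in>UNIV. teich N z (x i) ^ t i))"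
    using q by (simp add: teich_weight_def comp_frob_power teich_frob_power zN prod_eq_word_sum)
  also have "\<dots> = word_sum q S c k (\<lambda>t. \<Sum>x\<in>UNIV \<rightarrow>\<^sub>E ?fix. \<Prod>i\<in>UNIV. teich N z (x i) ^ t i)"
    by (simp add: word_sum_sum)
  also have "\<dots> = word_sum q S c k (\<lambda>t. \<Sum>I\<in>Pow UNIV. (-1) ^ card I * (of_nat (q ^ (CARD('n) - card I)) ^ k *
      of_bool (\<forall>i. ?M dvd t i \<and> (i \<in> I \<longrightarrow> t i > 0))))"
  proof (rule arg_cong[where f = "word_sum q S c k"], rule ext)
    fix t :: "'n \<Rightarrow> nat"
    have bool: "(\<Prod>i\<in>J. of_bool (P i)) = (of_bool (\<forall>i\<in>J. P i) :: 'a)" for J :: "'n set" and P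
      by (induction J rule: infinite_finite_induct) auto
    have "(\<Sum>x\<in>UNIV \<rightarrow>\<^sub>E ?fix. \<Prod>i\<in>UNIV. teich N z (x i) ^ t i) = (\<Prod>i\<in>UNIV. \<Sum>j\<in>?fix. teich N z j ^ t i)"
      by (rule prod_sum_PiE[symmetric]) auto
    also have "\<dots> = (\<Prod>i\<in>UNIV. of_bool (?M dvd t i)) * (\<Prod>i\<in>UNIV. of_nat (q ^ k) - of_bool (t i > 0))"
      by (simp only: sum_teich_power[OF z N K q k] prod.distrib)
    also have "(\<Prod>i\<in>UNIV. of_nat (q ^ k) - of_bool (t i > 0)) =
        (\<Sum>I\<in>Pow UNIV. (-1) ^ card I * of_bool (\<forall>i\<in>I. t i > 0) * of_nat (q ^ k) ^ (CARD('n) - card I) :: 'a)"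
      by (subst prod_diff_conv_sum) (simp_all add: bool card_Diff_subset)
    also have "(\<Prod>i\<in>UNIV. of_bool (?M dvd t i)) * \<dots> = (\<Sum>I\<in>Pow UNIV. (-1) ^ card I * (of_nat (q ^ (CARD('n) - card I)) ^ k *
      of_bool (\<forall>i. ?M dvd t i \<and> (i \<in> I \<longrightarrow> t i > 0))))"
      unfolding sum_distrib_left bool
      by (intro sum.cong refl) (auto simp: power_mult[symmetric] mult.commute)
    finally show "(\<Sum>x\<in>UNIV \<rightarrow>\<^sub>E ?fix. \<Prod>i\<in>UNIV. teich N z (x i) ^ t i) =
      (\<Sum>I\<in>Pow UNIV. (-1) ^ card I * (of_nat (q ^ (CARD('n) - card I)) ^ k *
      of_bool (\<forall>i. ?M dvd t i \<and> (i \<in> I \<longrightarrow> t i > 0))))" .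
  qed
  also have "\<dots> = (\<Sum>I\<in>Pow UNIV. (-1) ^ card I * mat_trace (dwork_mat d I q S c ^\<^sub>m k))"
    unfolding word_sum_sum word_sum_mult dwork_mat_def
    by (intro sum.cong refl arg_cong2[of _ _ _ _ "(*)"] trace_dwork_mat_power[symmetric] S q k)
  finally show ?thesis .
qed

text \<open>
  Equal traces of powers mean equal logarithmic derivatives, hence equal determinants up to \<open>T^m\<close>. The
  factors with odd \<open>card I\<close> are moved to the left to avoid inverses.
\<close>
lemma complex_det_identity:
  fixes z :: complex and S :: "('n::finite \<Rightarrow> nat) set"
  assumes z: "primitive_root N z" and N: "N = q ^ K - 1" and K: "K \<ge> 1" and q: "q \<ge> 2"
    and m: "\<And>k. 1 \<le> k \<Longrightarrow> k \<le> m \<Longrightarrow> k dvd K"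
    and S: "\<And>e. e \<in> S \<Longrightarrow> (\<Sum>i\<in>UNIV. e i) \<le> d * (q - 1)"
    and j: "j \<le> m"
  shows "coeff (det_one_minus_X (teich_mat N q z S c) * (\<Prod>I | odd (card I). det_one_minus_X (dwork_mat d I q S c))) j =
         coeff (\<Prod>I | even (card I). det_one_minus_X (dwork_mat d I q S c)) j"
proof -
  let ?D = "\<lambda>I. dwork_mat d I q S c" and ?F = "\<lambda>A. fps_of_poly (det_one_minus_X A)"
    and ?s = "\<lambda>A. trace_series (\<lambda>k. - mat_trace (A ^\<^sub>m k))"
  have ldD: "log_derivative (?F (?D I)) (?s (?D I))" for I
    by (rule log_derivative_det[OF dwork_mat_carrier])
  have ldT: "log_derivative (?F (teich_mat N q z S c)) (?s (teich_mat N q z S c))"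
    by (rule log_derivative_det[OF teich_mat_carrier])
  have "fps_nth (?F (teich_mat N q z S c) * (\<Prod>I | odd (card I). ?F (?D I))) j =
        fps_nth (\<Prod>I | even (card I). ?F (?D I)) j"
  proof (rule log_derivative_unique[OF _ _ _ j])
    show "log_derivative (?F (teich_mat N q z S c) * (\<Prod>I | odd (card I). ?F (?D I)))
        (?s (teich_mat N q z S c) + (\<Sum>I | odd (card I). ?s (?D I)))"
      by (intro log_derivative_mult log_derivative_prod ldD ldT)
    show "log_derivative (\<Prod>I | even (card I). ?F (?D I)) (\<Sum>I | even (card I). ?s (?D I))"
      by (intro log_derivative_prod ldD)
    fix k assume k: "k \<le> m"
    show "fps_nth (?s (teich_mat N q z S c) + (\<Sum>I | odd (card I). ?s (?D I))) k =
       fps_nth (\<Sum>I | even (card I). ?s (?D I)) k"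
    proof (cases "k = 0")
      case True
      thus ?thesis by (simp add: trace_series_def fps_sum_nth)
    next
      case False
      hence k1: "k \<ge> 1" "k dvd K" using m k by auto
      let ?t = "\<lambda>I. mat_trace (?D I ^\<^sub>m k)"
      have "mat_trace (teich_mat N q z S c ^\<^sub>m k) = (\<Sum>I\<in>UNIV. (-1) ^ card I * ?t I)"
        using trace_teich_mat_power[OF z N K q k1 S, where c = c] by simp
      also have "\<dots> = (\<Sum>I | even (card I). (-1) ^ card I * ?t I) + (\<Sum>I | odd (card I). (-1) ^ card I * ?t I)"
        by (subst sum.union_disjoint[symmetric]) (auto intro!: sum.cong)
      also have "(\<Sum>I | even (card I). (-1) ^ card I * ?t I) = (\<Sum>I | even (card I). ?t I)"
        by (intro sum.cong) auto
      also have "(\<Sum>I | odd (card I). (-1) ^ card I * ?t I) = - (\<Sum>I | odd (card I). ?t I)"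
        unfolding sum_negf[symmetric] by (intro sum.cong) auto
      finally show ?thesis
        using False by (simp add: trace_series_def fps_sum_nth sum_negf)
    qed
  qed
  thus ?thesis
    by (simp flip: fps_of_poly_nth add: fps_of_poly_mult fps_of_poly_prod)
qed

lemma map_teich_mat:
  assumes "comm_ring_hom h"
  shows "map_mat h (teich_mat N q z S c) = teich_mat N q (h z) S (\<lambda>e. h (c e))"
proof -
  interpret comm_ring_hom h by fact
  show ?thesis
    by (simp add: teich_mat_def weighted_map_mat_def map_mat_mat_on teich_weight_def teich_def
      hom_distribs of_bool_def if_distrib[of h] cong: if_cong)
qed

lemma map_dwork_mat:
  assumes "comm_ring_hom h"
  shows "map_mat h (dwork_mat d I q S c) = dwork_mat d I q S (\<lambda>e. h (c e))"
proof -
  interpret comm_ring_hom h by fact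
  show ?thesis
    by (simp add: dwork_mat_def map_mat_mat_on dwork_entry_def hom_distribs of_bool_def if_distrib[of h] cong: if_cong)
qed

text \<open>
  Both sides are images of polynomials over the integer polynomials, with \<open>g\<close> in place of the
  indeterminate. They agree at all complex primitive roots of unity, hence at \<open>g\<close>.
\<close>
lemma det_identity:
  fixes g :: "'a::idom" and S :: "('n::finite \<Rightarrow> nat) set" and c :: "('n \<Rightarrow> nat) \<Rightarrow> int poly"
  assumes g: "primitive_root N g" and N: "N = q ^ K - 1" and K: "K \<ge> 1" and q: "q \<ge> 2"
    and m: "\<And>k. 1 \<le> k \<Longrightarrow> k \<le> m \<Longrightarrow> k dvd K"
    and S: "\<And>e. e \<in> S \<Longrightarrow> (\<Sum>i\<in>UNIV. e i) \<le> d * (q - 1)"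
    and j: "j \<le> m"
  defines "c' \<equiv> \<lambda>e. int_poly_eval g (c e)"
  shows "coeff (det_one_minus_X (teich_mat N q g S c') * (\<Prod>I | odd (card I). det_one_minus_X (dwork_mat d I q S c'))) j =
         coeff (\<Prod>I | even (card I). det_one_minus_X (dwork_mat d I q S c')) j"
proof -
  define x where "x = (monom 1 1 :: int poly)"
  define L where "L = det_one_minus_X (teich_mat N q x S c) * (\<Prod>I | odd (card I). det_one_minus_X (dwork_mat d I q S c))"
  define R where "R = (\<Prod>I | even (card I). det_one_minus_X (dwork_mat d I q S c))"
  have L: "coeff (det_one_minus_X (teich_mat N q z S (\<lambda>e. int_poly_eval z (c e))) *
       (\<Prod>I | odd (card I). det_one_minus_X (dwork_mat d I q S (\<lambda>e. int_poly_eval z (c e))))) j = int_poly_eval z (coeff L j)"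
    and R: "coeff (\<Prod>I | even (card I). det_one_minus_X (dwork_mat d I q S (\<lambda>e. int_poly_eval z (c e)))) j
       = int_poly_eval z (coeff R j)" for z :: "'b::comm_ring_1"
  proof -
    interpret mp: map_poly_comm_ring_hom "int_poly_eval z" ..
    have T: "det_one_minus_X (teich_mat N q z S (\<lambda>e. int_poly_eval z (c e))) =
       map_poly (int_poly_eval z) (det_one_minus_X (teich_mat N q x S c))"
      unfolding det_one_minus_X_hom[OF comm_ring_hom_int_poly_eval teich_mat_carrier, symmetric]
      by (simp add: map_teich_mat[OF comm_ring_hom_int_poly_eval] x_def)
    have D: "det_one_minus_X (dwork_mat d I q S (\<lambda>e. int_poly_eval z (c e))) =
       map_poly (int_poly_eval z) (det_one_minus_X (dwork_mat d I q S c))" for I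
      unfolding det_one_minus_X_hom[OF comm_ring_hom_int_poly_eval dwork_mat_carrier, symmetric]
      by (simp add: map_dwork_mat[OF comm_ring_hom_int_poly_eval])
    show "coeff (det_one_minus_X (teich_mat N q z S (\<lambda>e. int_poly_eval z (c e))) *
       (\<Prod>I | odd (card I). det_one_minus_X (dwork_mat d I q S (\<lambda>e. int_poly_eval z (c e))))) j = int_poly_eval z (coeff L j)"
      "coeff (\<Prod>I | even (card I). det_one_minus_X (dwork_mat d I q S (\<lambda>e. int_poly_eval z (c e)))) j
       = int_poly_eval z (coeff R j)"
      unfolding T D L_def R_def by (simp_all flip: mp.hom_prod mp.hom_mult)
  qed
  have qK: "q ^ K > 1" using K q by (intro one_less_power) auto
  have "int_poly_eval g (coeff L j - coeff R j) = 0"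
  proof (rule specialize_primitive_root[OF g])
    show "N > 0" using N qK by simp
    fix z :: complex assume z: "primitive_root N z"
    have "int_poly_eval z (coeff L j) = int_poly_eval z (coeff R j)"
      unfolding L[symmetric] R[symmetric] by (rule complex_det_identity[OF z N K q m S j])
    thus "int_poly_eval z (coeff L j - coeff R j) = 0"
      by (simp add: int_poly_eval.hom_minus)
  qed
  thus ?thesis
    unfolding c'_def L R by (simp add: int_poly_eval.hom_minus)
qed

lemma det_one_minus_X_zero:
  assumes "finite A"
  shows "det_one_minus_X (mat_on A (\<lambda>a b. 0)) = (1 :: 'a::comm_ring_1 poly)"
proof -
  have "det_one_minus_X (mat_on A (\<lambda>a b. 0)) = (\<Prod>i<card A. [:1, - (mat_on A (\<lambda>a b. 0 :: 'a)) $$ (i, i):])"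
    by (rule det_one_minus_X_upper_triangular) (auto simp: mat_on_def upper_triangular_def)
  also have "\<dots> = 1" by (simp add: mat_on_def flip: one_pCons)
  finally show ?thesis .
qed

lemma det_identity_mod_p:
  fixes g :: "'a::idom" and S :: "('n::finite \<Rightarrow> nat) set" and c :: "('n \<Rightarrow> nat) \<Rightarrow> int poly"
  assumes g: "primitive_root N g" and N: "N = q ^ K - 1" and K: "K \<ge> 1" and q: "q \<ge> 2"
    and m: "\<And>k. 1 \<le> k \<Longrightarrow> k \<le> m \<Longrightarrow> k dvd K"
    and S: "\<And>e. e \<in> S \<Longrightarrow> (\<Sum>i\<in>UNIV. e i) \<le> d * (q - 1)"
    and j: "j \<le> m" and q0: "of_nat q = (0 :: 'a)"
  defines "c' \<equiv> \<lambda>e. int_poly_eval g (c e)"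
  defines "T \<equiv> det_one_minus_X (teich_mat N q g S c')"
    and "D \<equiv> det_one_minus_X (mat_on (exponent_box d UNIV) (dwork_entry q S c'))"
  shows "coeff (if even CARD('n) then T else T * D) j = coeff (if even CARD('n) then D else 1) j"
proof -
  have a: "det_one_minus_X (dwork_mat d I q S c') = 1" if "I \<noteq> UNIV" for I
  proof -
    have "card I < CARD('n)" using that by (intro psubset_card_mono) auto
    hence z: "of_nat (q ^ (CARD('n) - card I)) = (0 :: 'a)" by (simp add: q0)
    show ?thesis
      unfolding dwork_mat_def z mult_zero_left by (rule det_one_minus_X_zero[OF finite_exponent_box])
  qed
  have b: "det_one_minus_X (dwork_mat d UNIV q S c') = D"
    by (simp add: dwork_mat_def D_def)
  have *: "(\<Prod>I | P I. det_one_minus_X (dwork_mat d I q S c')) = (if P UNIV then D else 1)" for P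
  proof -
    have "(\<Prod>I | P I. det_one_minus_X (dwork_mat d I q S c')) = (\<Prod>I | P I. if I = UNIV then D else 1)"
      using a b by (intro prod.cong refl) auto
    also have "\<dots> = (if P UNIV then D else 1)" by (subst prod.delta) auto
    finally show ?thesis .
  qed
  show ?thesis
    using det_identity[OF g N K q m _ j, where c = c and S = S and d = d] S unfolding c'_def[symmetric] *
    by (auto simp: T_def split: if_splits)
qed

section \<open>Evaluation of polynomials and the Frobenius map\<close>

lemma mpoly_eval_superset:
  assumes "finite A" "Poly_Mapping.keys f \<subseteq> A"
  shows "mpoly_eval f x = (\<Sum>u\<in>A. to_ac (Poly_Mapping.lookup f u) * (\<Prod>i\<in>UNIV. x i ^ Poly_Mapping.lookup u i))"
  unfolding mpoly_eval_def using assms by (intro sum.mono_neutral_left) (auto simp: in_keys_iff)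

lemma mpoly_eval_single:
  "mpoly_eval (Poly_Mapping.single u c) x = to_ac c * (\<Prod>i\<in>UNIV. x i ^ Poly_Mapping.lookup u i)"
  by (simp add: mpoly_eval_superset[of "{u}"])

lemma mpoly_eval_add: "mpoly_eval (f + g) x = mpoly_eval f x + mpoly_eval g x"
proof -
  let ?A = "Poly_Mapping.keys f \<union> Poly_Mapping.keys g"
  have "Poly_Mapping.keys (f + g) \<subseteq> ?A" by (rule Poly_Mapping.keys_add)
  thus ?thesis
    by (simp add: mpoly_eval_superset[of ?A] lookup_add distrib_right sum.distrib)
qed

lemma mpoly_eval_0: "mpoly_eval 0 x = 0"
  by (simp add: mpoly_eval_def)

lemma mpoly_eval_sum: "mpoly_eval (\<Sum>a\<in>A. f a) x = (\<Sum>a\<in>A. mpoly_eval (f a) x)"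
  by (induction A rule: infinite_finite_induct) (auto simp: mpoly_eval_add mpoly_eval_0)

lemma mpoly_sum_monomials:
  "f = (\<Sum>u\<in>Poly_Mapping.keys f. Poly_Mapping.single u (Poly_Mapping.lookup f u))"
proof (rule poly_mapping_eqI)
  fix v
  have "(\<Sum>u\<in>Poly_Mapping.keys f. Poly_Mapping.lookup (Poly_Mapping.single u (Poly_Mapping.lookup f u)) v)
     = (\<Sum>u\<in>Poly_Mapping.keys f. if u = v then Poly_Mapping.lookup f v else 0)"
    by (intro sum.cong) (auto simp: lookup_single)
  thus "Poly_Mapping.lookup f v = Poly_Mapping.lookup (\<Sum>u\<in>Poly_Mapping.keys f. Poly_Mapping.single u (Poly_Mapping.lookup f u)) v"
    by (simp add: lookup_sum in_keys_iff)
qed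

lemma mpoly_eval_mult: "mpoly_eval (f * g) x = mpoly_eval f x * mpoly_eval g x"
proof -
  let ?m = "\<lambda>f u. Poly_Mapping.single u (Poly_Mapping.lookup f u)"
  have "f * g = (\<Sum>u\<in>Poly_Mapping.keys f. ?m f u) * (\<Sum>v\<in>Poly_Mapping.keys g. ?m g v)"
    by (simp flip: mpoly_sum_monomials)
  also have "mpoly_eval \<dots> x = (\<Sum>u\<in>Poly_Mapping.keys f. \<Sum>v\<in>Poly_Mapping.keys g. mpoly_eval (?m f u) x * mpoly_eval (?m g v) x)"
    by (simp add: sum_product mpoly_eval_sum mult_single mpoly_eval_single lookup_add power_add prod.distrib mult_ac)
  also have "\<dots> = mpoly_eval f x * mpoly_eval g x"
    by (simp only: mpoly_eval_single mpoly_eval_def[of f] mpoly_eval_def[of g] sum_product)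
  finally show ?thesis .
qed

lemma mpoly_eval_1: "mpoly_eval 1 x = 1"
  using mpoly_eval_single[of 0 1 x] by simp

lemma mpoly_eval_power: "mpoly_eval (f ^ k) x = mpoly_eval f x ^ k"
  by (induction k) (simp_all add: mpoly_eval_mult mpoly_eval_1)

lemma mdegree_add: "mdegree (u + v) = mdegree u + mdegree v"
  by (simp add: mdegree_def lookup_add sum.distrib)

lemma mdegree_le_total_degree: "u \<in> Poly_Mapping.keys f \<Longrightarrow> mdegree u \<le> total_degree f"
  by (simp add: total_degree_def)

lemma mdegree_keys_power:
  assumes "u \<in> Poly_Mapping.keys (f ^ k)"
  shows "mdegree u \<le> total_degree f * k"
  using assms
proof (induction k arbitrary: u)
  case 0
  hence "u = 0" by (simp add: in_keys_iff lookup_one when_def split: if_splits)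
  thus ?case by (simp add: mdegree_def)
next
  case (Suc k)
  then obtain a b where "u = a + b" "a \<in> Poly_Mapping.keys f" "b \<in> Poly_Mapping.keys (f ^ k)"
    using keys_mult[of f "f ^ k"] by auto
  thus ?case using Suc.IH[of b] mdegree_le_total_degree[of a f] by (simp add: mdegree_add)
qed

lemma sum_power_CARD:
  fixes h :: "'b \<Rightarrow> 'a::finite_field alg_closure"
  shows "(\<Sum>i\<in>A. h i) ^ CARD('a) = (\<Sum>i\<in>A. h i ^ CARD('a))"
proof (induction A rule: infinite_finite_induct)
  case (insert i A)
  thus ?case using add_power_CARD[of "h i" "sum h A" 1] by simp
qed (simp_all add: zero_power)

lemma mpoly_eval_frobenius:
  fixes f :: "('n::finite, 'a::finite_field) mpoly"
  shows "mpoly_eval f (\<lambda>i. x i ^ CARD('a)) = mpoly_eval f x ^ CARD('a)"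
proof -
  have "to_ac c ^ CARD('a) = to_ac c" for c :: 'a
    by (simp add: finite_field_power_card_eq_same flip: to_ac_power)
  hence "mpoly_eval f x ^ CARD('a) = (\<Sum>u\<in>Poly_Mapping.keys f. to_ac (Poly_Mapping.lookup f u) *
      (\<Prod>i\<in>UNIV. x i ^ Poly_Mapping.lookup u i) ^ CARD('a))"
    by (simp add: mpoly_eval_def sum_power_CARD power_mult_distrib)
  also have "\<dots> = mpoly_eval f (\<lambda>i. x i ^ CARD('a))"
    by (simp add: mpoly_eval_def prod_power_distrib power_mult[symmetric] mult.commute)
  finally show ?thesis ..
qed

lemma mpoly_eval_frobenius_power:
  fixes f :: "('n::finite, 'a::finite_field) mpoly"
  shows "mpoly_eval f (\<lambda>i. x i ^ (CARD('a) ^ k)) = mpoly_eval f x ^ (CARD('a) ^ k)"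
proof (induction k)
  case (Suc k)
  have *: "y ^ (CARD('a) ^ Suc k) = (y ^ (CARD('a) ^ k)) ^ CARD('a)" for y :: "'a alg_closure"
    by (simp add: power_mult[symmetric] mult.commute)
  show ?case unfolding * by (simp add: mpoly_eval_frobenius Suc)
qed auto

section \<open>Rational points\<close>

lemma ext_field_mono:
  assumes "k dvd K"
  shows "ext_field k \<subseteq> (ext_field K :: 'a::finite_field alg_closure set)"
proof
  fix x :: "'a alg_closure" assume x: "x \<in> ext_field k"
  from assms obtain m where m: "K = k * m" by (auto elim: dvdE)
  have "x ^ ((CARD('a) ^ k) ^ i) = x" for i
  proof (induction i)
    case (Suc i)
    have "x ^ ((CARD('a) ^ k) ^ Suc i) = (x ^ ((CARD('a) ^ k) ^ i)) ^ (CARD('a) ^ k)"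
      by (simp add: power_mult[symmetric] mult.commute)
    thus ?case using Suc x by (simp add: ext_field_def)
  qed auto
  thus "x \<in> ext_field K" by (simp add: ext_field_def m power_mult)
qed

text \<open>
  The encoding turns \<open>frob\<close> into the Frobenius map, so it restricts to a bijection of fixed points.
\<close>
lemma bij_betw_teich:
  fixes g :: "'a::finite_field alg_closure"
  assumes K: "K \<ge> 1" and N: "N = CARD('a) ^ K - 1" and g: "primitive_root N g"
    and gen: "ext_field K - {0} = (\<lambda>j. g ^ j) ` {..<N}" and k: "k dvd K"
  shows "bij_betw (teich N g) {j. j \<le> N \<and> (frob N CARD('a) ^^ k) j = j} (ext_field k)"
proof -
  have qK: "CARD('a) ^ K > 1" using K card_finite_field_gt_1[where 'a='a] by (intro one_less_power) auto
  have "(0 :: 'a alg_closure) \<in> ext_field K" by (simp add: ext_field_def)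
  have im: "teich N g ` {..N} = ext_field K"
  proof -
    have "{..N} = insert N {..<N}" by auto
    hence "teich N g ` {..N} = insert 0 ((\<lambda>j. g ^ j) ` {..<N})" by (auto simp: teich_def)
    also have "\<dots> = ext_field K" using gen \<open>0 \<in> ext_field K\<close> by blast
    finally show ?thesis .
  qed
  have "card {..N} = card (ext_field K :: 'a alg_closure set)"
    using card_ext_field(2)[OF K, where 'a='a] qK by (simp add: N)
  hence inj: "inj_on (teich N g) {..N}"
    using im by (intro eq_card_imp_inj_on) auto
  have fix_iff: "(frob N CARD('a) ^^ k) j = j \<longleftrightarrow> teich N g j \<in> ext_field k" if j: "j \<le> N" for j
  proof -
    have "(frob N CARD('a) ^^ k) j \<le> N" using j mod_less_divisor[of N] by (auto simp: frob_power intro: less_imp_le)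
    hence "(frob N CARD('a) ^^ k) j = j \<longleftrightarrow> teich N g ((frob N CARD('a) ^^ k) j) = teich N g j"
      using j inj by (auto simp: inj_on_eq_iff)
    thus ?thesis
      using g by (subst (asm) teich_frob_power) (auto simp: primitive_root_def ext_field_def)
  qed
  show ?thesis
    unfolding bij_betw_def
  proof
    show "inj_on (teich N g) {j. j \<le> N \<and> (frob N CARD('a) ^^ k) j = j}"
      by (rule inj_on_subset[OF inj]) auto
    show "teich N g ` {j. j \<le> N \<and> (frob N CARD('a) ^^ k) j = j} = ext_field k"
    proof (intro equalityI subsetI)
      fix y :: "'a alg_closure" assume y: "y \<in> ext_field k"
      then obtain j where "j \<le> N" "y = teich N g j" using ext_field_mono[OF k] im by blast
      thus "y \<in> teich N g ` {j. j \<le> N \<and> (frob N CARD('a) ^^ k) j = j}" using y fix_iff by auto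
    qed (use fix_iff in auto)
  qed
qed

text \<open>
  The nonzeros and the zeros of \<open>f\<close> together make up the affine space over the field with \<open>q^k\<close> elements.
\<close>
lemma card_nonzeros:
  fixes f :: "('n::finite, 'a::finite_field) mpoly" and g :: "'a alg_closure"
  assumes K: "K \<ge> 1" and N: "N = CARD('a) ^ K - 1" and g: "primitive_root N g"
    and gen: "ext_field K - {0} = (\<lambda>j. g ^ j) ` {..<N}" and k: "k dvd K" "k \<ge> 1"
  shows "card {x \<in> teich_points N. (((\<circ>) (frob N CARD('a))) ^^ k) x = x \<and> mpoly_eval f (\<lambda>i. teich N g (x i)) \<noteq> 0} + num_points f k
    = (CARD('a) ^ CARD('n)) ^ k"
proof -
  let ?A = "{j. j \<le> N \<and> (frob N CARD('a) ^^ k) j = j}" and ?E = "ext_field k :: 'a alg_closure set"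
  let ?V = "{y :: 'n \<Rightarrow> 'a alg_closure. (\<forall>i. y i \<in> ?E) \<and> mpoly_eval f y \<noteq> 0}"
    and ?Z = "{y :: 'n \<Rightarrow> 'a alg_closure. (\<forall>i. y i \<in> ?E) \<and> mpoly_eval f y = 0}"
  let ?S = "{x \<in> teich_points N. (((\<circ>) (frob N CARD('a))) ^^ k) x = x \<and> mpoly_eval f (\<lambda>i. teich N g (x i)) \<noteq> 0}"
  note bij = bij_betw_teich[OF K N g gen k(1)]
  have fin: "finite ?E" "card ?E = CARD('a) ^ k" using card_ext_field[OF k(2)] by auto
  have S: "?S = {x. (\<forall>i. x i \<in> ?A) \<and> mpoly_eval f (\<lambda>i. teich N g (x i)) \<noteq> 0}"
    by (auto simp: teich_points_def comp_frob_power fun_eq_iff)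
  have "bij_betw (\<lambda>x i. teich N g (x i)) ?S ?V"
    unfolding S bij_betw_def
  proof
    show "inj_on (\<lambda>x i. teich N g (x i)) {x. (\<forall>i. x i \<in> ?A) \<and> mpoly_eval f (\<lambda>i. teich N g (x i)) \<noteq> 0}"
    proof (rule inj_onI, rule ext)
      fix x y :: "'n \<Rightarrow> nat" and i
      assume "x \<in> {x. (\<forall>i. x i \<in> ?A) \<and> mpoly_eval f (\<lambda>i. teich N g (x i)) \<noteq> 0}"
        "y \<in> {x. (\<forall>i. x i \<in> ?A) \<and> mpoly_eval f (\<lambda>i. teich N g (x i)) \<noteq> 0}"
      hence "x i \<in> ?A" "y i \<in> ?A" by auto
      moreover assume "(\<lambda>i. teich N g (x i)) = (\<lambda>i. teich N g (y i))"
      hence "teich N g (x i) = teich N g (y i)" by (rule fun_cong)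
      ultimately show "x i = y i" using bij by (meson bij_betw_imp_inj_on inj_onD)
    qed
    show "(\<lambda>x i. teich N g (x i)) ` {x. (\<forall>i. x i \<in> ?A) \<and> mpoly_eval f (\<lambda>i. teich N g (x i)) \<noteq> 0} = ?V"
    proof (intro equalityI subsetI)
      fix y assume y: "y \<in> ?V"
      define x where "x i = inv_into ?A (teich N g) (y i)" for i
      have x: "x i \<in> ?A" "teich N g (x i) = y i" for i
      proof -
        have "y i \<in> teich N g ` ?A" using y bij by (auto simp: bij_betw_def)
        thus "x i \<in> ?A" "teich N g (x i) = y i"
          unfolding x_def by (rule inv_into_into, rule f_inv_into_f)
      qed
      have "y = (\<lambda>i. teich N g (x i))" using x(2) by auto
      thus "y \<in> (\<lambda>x i. teich N g (x i)) ` {x. (\<forall>i. x i \<in> ?A) \<and> mpoly_eval f (\<lambda>i. teich N g (x i)) \<noteq> 0}"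
        using x(1) y by blast
    qed (use bij in \<open>auto simp: bij_betw_def\<close>)
  qed
  hence "card ?S = card ?V" by (rule bij_betw_same_card)
  moreover have "num_points f k = card ?Z" by (simp add: num_points_def)
  moreover have "card ?V + card ?Z = (CARD('a) ^ CARD('n)) ^ k"
  proof -
    have U: "?V \<union> ?Z = (UNIV \<rightarrow>\<^sub>E ?E)" by auto
    have "finite (UNIV \<rightarrow>\<^sub>E ?E :: ('n \<Rightarrow> 'a alg_closure) set)" using fin by (intro finite_PiE) auto
    hence "finite ?V" "finite ?Z" unfolding U[symmetric] by auto
    hence "card ?V + card ?Z = card (?V \<union> ?Z)"
      by (intro card_Un_disjoint[symmetric]) auto
    also have "\<dots> = (CARD('a) ^ CARD('n)) ^ k"
      unfolding U by (subst card_PiE) (auto simp: fin power_mult[symmetric] mult.commute)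
    finally show ?thesis .
  qed
  ultimately show ?thesis by simp
qed

section \<open>The zeta function as a determinant modulo a power of T\<close>

lemma log_derivative_zeta: "log_derivative (zeta f) (trace_series (\<lambda>k. of_nat (num_points f k)))"
proof -
  define A :: "rat fps" where "A = Abs_fps (\<lambda>k. if k = 0 then 0 else of_nat (num_points f k) / of_nat k)"
  have z: "zeta f = fps_exp 1 oo A" by (simp add: zeta_def A_def)
  have A0: "fps_nth A 0 = 0" by (simp add: A_def)
  have "fps_deriv (zeta f) = (fps_exp 1 oo A) * fps_deriv A"
    unfolding z by (subst fps_compose_deriv[OF A0]) simp
  hence "fps_X * fps_deriv (zeta f) = (fps_X * fps_deriv A) * zeta f" by (simp add: z mult_ac)
  also have "fps_X * fps_deriv A = trace_series (\<lambda>k. of_nat (num_points f k))"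
  proof (rule fps_ext)
    fix j show "fps_nth (fps_X * fps_deriv A) j = fps_nth (trace_series (\<lambda>k. of_nat (num_points f k))) j"
      by (cases j) (simp_all add: A_def trace_series_def)
  qed
  finally show ?thesis by (simp add: log_derivative_def z A0)
qed

lemma finite_field_of_nat_CARD: "of_nat CARD('a) = (0 :: 'a::finite_field)"
proof -
  have "(\<Sum>x\<in>UNIV. x + 1) = (\<Sum>x\<in>UNIV. x :: 'a)"
    by (rule sum.reindex_bij_witness[of _ "\<lambda>x. x - 1" "\<lambda>x. x + 1"]) auto
  thus ?thesis by (simp add: sum.distrib)
qed

text \<open>
  The Frobenius map on the points where \<open>f\<close> does not vanish, extended by zero to all points. The entries
  are \<open>0\<close> and \<open>1\<close>, so the matrix makes sense over every ring; it is needed over the integers,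
  the complex numbers and the algebraic closure.
\<close>
definition complement_mat :: "nat \<Rightarrow> 'a alg_closure \<Rightarrow> ('n::finite, 'a::finite_field) mpoly \<Rightarrow> 'b::comm_ring_1 mat" where
  "complement_mat N g f = weighted_map_mat (teich_points N) ((\<circ>) (frob N CARD('a)))
     (\<lambda>x. of_bool (mpoly_eval f (\<lambda>i. teich N g (x i)) \<noteq> 0))"

lemma map_complement_mat:
  assumes "comm_ring_hom h"
  shows "map_mat h (complement_mat N g f) = complement_mat N g f"
proof -
  interpret comm_ring_hom h by fact
  show ?thesis
    by (simp add: complement_mat_def weighted_map_mat_def map_mat_mat_on hom_distribs of_bool_def if_distrib[of h] cong: if_cong)
qed

lemma complement_mat_carrier:
  "(complement_mat N g (f :: ('n::finite, 'a::finite_field) mpoly) :: 'b::comm_ring_1 mat)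
     \<in> carrier_mat (card (teich_points N :: ('n \<Rightarrow> nat) set)) (card (teich_points N :: ('n \<Rightarrow> nat) set))"
  by (simp add: complement_mat_def weighted_map_mat_def)

lemma det_complement_mat:
  assumes "comm_ring_hom (h :: 'b::comm_ring_1 \<Rightarrow> 'c::comm_ring_1)"
  shows "det_one_minus_X (complement_mat N g f) = map_poly h (det_one_minus_X (complement_mat N g f))"
  using det_one_minus_X_hom[OF assms complement_mat_carrier] by (simp add: map_complement_mat[OF assms])

lemma mpoly_eval_teich_frob:
  fixes f :: "('n::finite, 'a::finite_field) mpoly"
  assumes "primitive_root N g"
  shows "mpoly_eval f (\<lambda>i. teich N g ((((\<circ>) (frob N CARD('a)) ^^ k) x) i)) =
    mpoly_eval f (\<lambda>i. teich N g (x i)) ^ (CARD('a) ^ k)"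
  using assms by (simp add: comp_frob_power teich_frob_power primitive_root_def mpoly_eval_frobenius_power)

lemma fps_mult_linear_nth:
  fixes h :: "'a::comm_ring_1 fps"
  shows "fps_nth (h * (1 - fps_const c * fps_X)) j = fps_nth h j - (if j = 0 then 0 else c * fps_nth h (j - 1))"
proof -
  have "h * (1 - fps_const c * fps_X) = h - fps_const c * (fps_X * h)"
    by (simp add: algebra_simps)
  thus ?thesis by simp
qed

text \<open>
  Over the complex numbers both sides have the same logarithmic derivative up to \<open>T^m\<close>: the coefficient is
  the number of points minus \<open>q^(n k)\<close> on the left, and minus the trace of the \<open>k\<close>-th power, which
  counts the points outside \<open>X\<close>, on the right.
\<close>
lemma zeta_eq_det_complement:
  fixes f :: "('n::finite, 'a::finite_field) mpoly" and g :: "'a alg_closure"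
  assumes K: "K \<ge> 1" and N: "N = CARD('a) ^ K - 1" and g: "primitive_root N g"
    and gen: "ext_field K - {0} = (\<lambda>j. g ^ j) ` {..<N}"
    and m: "\<And>k. 1 \<le> k \<Longrightarrow> k \<le> m \<Longrightarrow> k dvd K" and j: "j \<le> m"
  shows "fps_nth (zeta f * (1 - fps_const (of_nat (CARD('a) ^ CARD('n))) * fps_X)) j
    = of_int (coeff (det_one_minus_X (complement_mat N g f)) j)"
proof -
  define Q where "Q = CARD('a) ^ CARD('n)"
  define P where "P = (complement_mat N g f :: complex mat)"
  let ?F = "Abs_fps (\<lambda>k. of_rat (fps_nth (zeta f) k)) :: complex fps"
  let ?\<phi> = "(\<circ>) (frob N CARD('a)) :: ('n \<Rightarrow> nat) \<Rightarrow> _"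
  let ?s = "trace_series (\<lambda>k. of_nat (num_points f k) :: rat)"
  have hom: "comm_ring_hom (of_rat :: rat \<Rightarrow> complex)"
    by standard (auto simp: of_rat_add of_rat_mult)
  have F: "log_derivative ?F (Abs_fps (\<lambda>k. of_rat (fps_nth ?s k)))"
    by (rule log_derivative_map[OF hom log_derivative_zeta])
  have G: "log_derivative (?F * fps_of_poly [:1, - of_nat Q:])
     (Abs_fps (\<lambda>k. of_rat (fps_nth ?s k)) + trace_series (\<lambda>k. - (of_nat Q ^ k)))"
    by (intro log_derivative_mult F log_derivative_linear_factor)
  have H: "log_derivative (fps_of_poly (det_one_minus_X P)) (trace_series (\<lambda>k. - mat_trace (P ^\<^sub>m k)))"
    unfolding P_def by (rule log_derivative_det[OF complement_mat_carrier])
  have lin: "fps_of_poly [:1, - of_nat Q:] = 1 - fps_const (of_nat Q :: complex) * fps_X"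
    by (simp add: fps_of_poly_pCons)
  have "fps_nth (?F * fps_of_poly [:1, - of_nat Q:]) j = fps_nth (fps_of_poly (det_one_minus_X P)) j"
  proof (rule log_derivative_unique[OF G H _ j])
    fix k assume k: "k \<le> m"
    show "fps_nth (Abs_fps (\<lambda>k. of_rat (fps_nth ?s k)) + trace_series (\<lambda>k. - (of_nat Q ^ k))) k
       = fps_nth (trace_series (\<lambda>k. - mat_trace (P ^\<^sub>m k))) k"
    proof (cases "k = 0")
      case False
      hence k1: "k dvd K" "k \<ge> 1" using m k by auto
      let ?W = "\<lambda>x. mpoly_eval f (\<lambda>i. teich N g (x i)) \<noteq> 0"
      have "mat_trace (P ^\<^sub>m k) = (\<Sum>x\<in>{x \<in> teich_points N. (?\<phi> ^^ k) x = x}. \<Prod>i<k. of_bool (?W ((?\<phi> ^^ i) x)))"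
        unfolding P_def complement_mat_def
        by (intro mat_trace_weighted_map_power finite_teich_points frob_teich_points)
      also have "\<dots> = (\<Sum>x\<in>{x \<in> teich_points N. (?\<phi> ^^ k) x = x}. of_bool (?W x))"
        using k1 by (intro sum.cong refl) (simp add: mpoly_eval_teich_frob[OF g] of_bool_def zero_power)
      also have "\<dots> = (\<Sum>x\<in>{x \<in> teich_points N. (?\<phi> ^^ k) x = x \<and> ?W x}. 1)"
        by (intro sum.mono_neutral_cong_right) (auto simp: finite_teich_points)
      finally have "mat_trace (P ^\<^sub>m k) = of_nat (card {x \<in> teich_points N. (?\<phi> ^^ k) x = x \<and> ?W x})" by simp
      hence "mat_trace (P ^\<^sub>m k) + of_nat (num_points f k) = of_nat Q ^ k"
        unfolding Q_def of_nat_power[symmetric] card_nonzeros[OF K N g gen k1, of f, symmetric] by simp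
      thus ?thesis using False by (simp add: trace_series_def algebra_simps)
    qed (simp add: trace_series_def)
  qed
  also have "fps_nth (fps_of_poly (det_one_minus_X P)) j = of_int (coeff (det_one_minus_X (complement_mat N g f)) j)"
    unfolding P_def by (subst det_complement_mat[of "of_int :: int \<Rightarrow> complex"]) (auto intro: of_int_hom.comm_ring_hom_axioms)
  also have "fps_nth (?F * fps_of_poly [:1, - of_nat Q:]) j =
      of_rat (fps_nth (zeta f * (1 - fps_const (of_nat Q) * fps_X)) j)"
    unfolding lin fps_mult_linear_nth by (simp add: of_rat_diff of_rat_mult)
  finally have "of_rat (fps_nth (zeta f * (1 - fps_const (of_nat Q) * fps_X)) j)
     = (of_rat (of_int (coeff (det_one_minus_X (complement_mat N g f)) j)) :: complex)" by simp
  thus ?thesis unfolding of_rat_eq_iff Q_def .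
qed

section \<open>The operator on the space spanned by monomials\<close>

lemma lookup_map_times: "Poly_Mapping.lookup (Poly_Mapping.map ((*) q) v) i = q * Poly_Mapping.lookup v i"
  for v :: "'n \<Rightarrow>\<^sub>0 nat"
  by (simp add: Poly_Mapping.map.rep_eq when_def)

lemma lookup_psi:
  fixes h :: "('n::finite, 'a::field) mpoly"
  assumes "q > 0"
  shows "Poly_Mapping.lookup (psi q h) v = Poly_Mapping.lookup h (Poly_Mapping.map ((*) q) v)"
proof -
  let ?qv = "Poly_Mapping.map ((*) q) v"
  note qv = lookup_map_times[of q v]
  have div: "Poly_Mapping.lookup (Poly_Mapping.map (\<lambda>m. m div q) u) i = Poly_Mapping.lookup u i div q" for u :: "'n \<Rightarrow>\<^sub>0 nat" and i
    by (simp add: Poly_Mapping.map.rep_eq when_def)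
  have iff: "(\<forall>i. q dvd Poly_Mapping.lookup u i) \<and> Poly_Mapping.map (\<lambda>m. m div q) u = v \<longleftrightarrow> u = ?qv" for u
  proof
    assume "(\<forall>i. q dvd Poly_Mapping.lookup u i) \<and> Poly_Mapping.map (\<lambda>m. m div q) u = v"
    thus "u = ?qv" by (intro poly_mapping_eqI) (auto simp: qv div)
  next
    assume "u = ?qv"
    thus "(\<forall>i. q dvd Poly_Mapping.lookup u i) \<and> Poly_Mapping.map (\<lambda>m. m div q) u = v"
      using assms by (auto intro!: poly_mapping_eqI simp: qv div)
  qed
  have "Poly_Mapping.lookup (psi q h) v = (\<Sum>u\<in>Poly_Mapping.keys h. if u = ?qv then Poly_Mapping.lookup h u else 0)"
    unfolding psi_def lookup_sum
    by (intro sum.cong refl) (auto simp: lookup_single when_def iff[symmetric])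
  also have "\<dots> = Poly_Mapping.lookup h ?qv"
    by (auto simp: in_keys_iff)
  finally show ?thesis .
qed

lemma exponent_box_of_lookup:
  "Poly_Mapping.lookup u \<in> exponent_box d UNIV \<longleftrightarrow> mdegree u \<le> d \<and> (\<forall>i. Poly_Mapping.lookup u i \<ge> 1)"
  by (auto simp: exponent_box_def mdegree_def Suc_le_eq)

lemma R_monomials_eq:
  "R_monomials d = (\<lambda>u. Poly_Mapping.single u 1 :: ('n::finite, 'a::field) mpoly) ` {u. Poly_Mapping.lookup u \<in> exponent_box d UNIV}"
  using R_monomials_iff[of _ d, where 'a = 'a]
  by (auto simp: exponent_box_of_lookup R_monomials_def monomials_def)

text \<open>
  Membership in the span becomes a condition on exponents, which makes the invariance of the space
  under \<open>\<psi>\<^sub>q \<circ> f^(q-1)\<close> a matter of degrees.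
\<close>
lemma R_space_eq:
  "R_space d = {h :: ('n::finite, 'a::field) mpoly. \<forall>u\<in>Poly_Mapping.keys h. Poly_Mapping.lookup u \<in> exponent_box d UNIV}"
proof (intro equalityI subsetI)
  let ?R = "{h :: ('n, 'a) mpoly. \<forall>u\<in>Poly_Mapping.keys h. Poly_Mapping.lookup u \<in> exponent_box d UNIV}"
  have "mpoly.subspace ?R"
  proof (rule mpoly.subspaceI)
    show "x + y \<in> ?R" if "x \<in> ?R" "y \<in> ?R" for x y
      using that Poly_Mapping.keys_add[of x y] by blast
  qed (auto simp: in_keys_iff)
  moreover have "R_monomials d \<subseteq> ?R"
    by (auto simp: R_monomials_eq)
  ultimately have "R_space d \<subseteq> ?R"
    unfolding R_space_def by (intro mpoly.span_minimal)
  thus "h \<in> ?R" if "h \<in> R_space d" for h using that by blast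
  fix h :: "('n, 'a) mpoly" assume h: "h \<in> ?R"
  have "h = (\<Sum>u\<in>Poly_Mapping.keys h. mscale (Poly_Mapping.lookup h u) (Poly_Mapping.single u 1))"
    using mpoly_sum_monomials[of h] by (simp add: mscale_eq_mult mult_single)
  also have "\<dots> \<in> R_space d"
    unfolding R_space_def using h
    by (intro mpoly.span_sum mpoly.span_scale mpoly.span_base) (auto simp: R_monomials_eq)
  finally show "h \<in> R_space d" .
qed

text \<open>
  If \<open>x^v\<close> occurs in \<open>\<psi>\<^sub>q (f^(q-1) h)\<close>, then \<open>q v = e + u\<close> with \<open>e\<close> from \<open>f^(q-1)\<close> and \<open>u\<close> from \<open>h\<close>. So \<open>v\<close> has
  degree at most \<open>(d (q - 1) + d) / q = d\<close>, and it is positive where \<open>u\<close> is.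
\<close>
lemma psi_mult_R_space:
  fixes f :: "('n::finite, 'a::finite_field) mpoly"
  shows "psi_mult f ` R_space (total_degree f) \<subseteq> R_space (total_degree f)"
proof safe
  let ?q = "CARD('a)" and ?d = "total_degree f"
  fix h :: "('n, 'a) mpoly" assume h: "h \<in> R_space ?d"
  have q: "?q > 1" by (rule card_finite_field_gt_1)
  show "psi_mult f h \<in> R_space ?d"
    unfolding R_space_eq
  proof safe
    fix v assume "v \<in> Poly_Mapping.keys (psi_mult f h)"
    hence "Poly_Mapping.map ((*) ?q) v \<in> Poly_Mapping.keys (f ^ (?q - 1) * h)"
      by (simp add: psi_mult_def lookup_psi in_keys_iff)
    then obtain e u where eu: "Poly_Mapping.map ((*) ?q) v = e + u" "e \<in> Poly_Mapping.keys (f ^ (?q - 1))"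
        "u \<in> Poly_Mapping.keys h"
      using keys_mult[of "f ^ (?q - 1)" h] by blast
    have u: "mdegree u \<le> ?d" "\<And>i. Poly_Mapping.lookup u i \<ge> 1"
      using h eu(3) by (auto simp: R_space_eq exponent_box_of_lookup)
    have v: "?q * Poly_Mapping.lookup v i = Poly_Mapping.lookup e i + Poly_Mapping.lookup u i" for i
      using arg_cong[OF eu(1), of "\<lambda>w. Poly_Mapping.lookup w i"]
      by (simp add: lookup_map_times lookup_add)
    have "?q * mdegree v = mdegree e + mdegree u"
      by (simp add: mdegree_def sum_distrib_left v sum.distrib)
    also have "\<dots> \<le> ?d * (?q - 1) + ?d"
      using mdegree_keys_power[OF eu(2)] u by (intro add_mono)
    also have "\<dots> = ?q * ?d" using q by (cases ?q) (simp_all add: algebra_simps)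
    finally have "mdegree v \<le> ?d" using q by simp
    moreover have "Poly_Mapping.lookup v i \<ge> 1" for i
      using v[of i] u(2)[of i] by (cases "Poly_Mapping.lookup v i") auto
    ultimately show "Poly_Mapping.lookup v \<in> exponent_box ?d UNIV"
      by (simp add: exponent_box_of_lookup)
  qed
qed

text \<open>
  Exponents are passed as plain functions to the matrices above.
\<close>
definition exponents :: "('n::finite, 'a::zero) mpoly \<Rightarrow> ('n \<Rightarrow> nat) set" where
  "exponents h = Poly_Mapping.lookup ` Poly_Mapping.keys h"

definition coefficient :: "('n::finite, 'a::zero) mpoly \<Rightarrow> ('n \<Rightarrow> nat) \<Rightarrow> 'a" where
  "coefficient h e = Poly_Mapping.lookup h (Abs_poly_mapping e)"

lemma Abs_poly_mapping_lookup [simp]: "Abs_poly_mapping (Poly_Mapping.lookup u) = u"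
  by (rule poly_mapping.lookup_inverse)

lemma lookup_Abs_poly_mapping_finite [simp]:
  "Poly_Mapping.lookup (Abs_poly_mapping (e :: 'n::finite \<Rightarrow> nat)) = e"
  by (rule lookup_Abs_poly_mapping) simp

lemma sum_exponents:
  "(\<Sum>e\<in>exponents h. F (coefficient h e) e) = (\<Sum>u\<in>Poly_Mapping.keys h. F (Poly_Mapping.lookup h u) (Poly_Mapping.lookup u))"
  unfolding exponents_def
  by (subst sum.reindex) (auto simp: inj_on_def poly_mapping.lookup_inject coefficient_def)

lemma lookup_psi_mult_monomial:
  fixes f :: "('n::finite, 'a::finite_field) mpoly"
  defines "F \<equiv> f ^ (CARD('a) - 1)"
  shows "Poly_Mapping.lookup (psi_mult f (Poly_Mapping.single u 1)) v =
    dwork_entry CARD('a) (exponents F) (coefficient F) (Poly_Mapping.lookup v) (Poly_Mapping.lookup u)"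
proof -
  let ?qv = "Poly_Mapping.map ((*) CARD('a)) v"
  have iff: "e + u = ?qv \<longleftrightarrow> (\<forall>i. CARD('a) * Poly_Mapping.lookup v i = Poly_Mapping.lookup e i + Poly_Mapping.lookup u i)" for e
    by (auto simp: poly_mapping_eq_iff fun_eq_iff lookup_add lookup_map_times)
  have "F * Poly_Mapping.single u 1 = (\<Sum>e\<in>Poly_Mapping.keys F. Poly_Mapping.single (e + u) (Poly_Mapping.lookup F e))"
    by (subst mpoly_sum_monomials[of F]) (simp add: sum_distrib_right mult_single)
  hence "Poly_Mapping.lookup (psi_mult f (Poly_Mapping.single u 1)) v =
     (\<Sum>e\<in>Poly_Mapping.keys F. Poly_Mapping.lookup F e * of_bool (e + u = ?qv))"
    by (simp add: psi_mult_def F_def lookup_psi lookup_sum lookup_single when_def of_bool_def if_distrib cong: if_cong)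
  thus ?thesis
    unfolding iff dwork_entry_def
    by (simp add: sum_exponents[where F = "\<lambda>c e. c * of_bool (\<forall>i. CARD('a) * Poly_Mapping.lookup v i = e i + Poly_Mapping.lookup u i)"])
qed

definition monomial_basis :: "nat \<Rightarrow> ('n::finite, 'a::field) mpoly list" where
  "monomial_basis d = map (\<lambda>v. Poly_Mapping.single (Abs_poly_mapping v) 1) (enum_set (exponent_box d UNIV))"

lemma set_monomial_basis: "set (monomial_basis d) = (R_monomials d :: ('n::finite, 'a::field) mpoly set)"
proof -
  have "exponent_box d (UNIV :: 'n set) = Poly_Mapping.lookup ` {u. Poly_Mapping.lookup u \<in> exponent_box d UNIV}"
    by (auto intro!: image_eqI[of _ _ "Abs_poly_mapping _"])
  hence "set (monomial_basis d) = (\<lambda>v. Poly_Mapping.single (Abs_poly_mapping v) 1 :: ('n, 'a) mpoly) ` Poly_Mapping.lookup ` {u. Poly_Mapping.lookup u \<in> exponent_box d UNIV}"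
    by (simp add: monomial_basis_def enum_set finite_exponent_box)
  thus ?thesis by (simp add: image_image R_monomials_eq)
qed

text \<open>
  The coordinate of a polynomial with respect to a monomial is its coefficient there.
\<close>
lemma independent_monomials:
  assumes "finite B" "B \<subseteq> monomials"
  shows "\<not> mpoly.dependent (B :: ('n::finite, 'a::field) mpoly set)"
    and "h \<in> mpoly.span B \<Longrightarrow> Poly_Mapping.single w 1 \<in> B \<Longrightarrow>
      mpoly.representation B h (Poly_Mapping.single w 1) = Poly_Mapping.lookup h w"
proof -
  have coeff: "Poly_Mapping.lookup (\<Sum>b\<in>B. mscale (c b) b) w = c (Poly_Mapping.single w 1)" if "Poly_Mapping.single w 1 \<in> B" for c w
  proof -
    have "Poly_Mapping.lookup (\<Sum>b\<in>B. mscale (c b) b) w = (\<Sum>b\<in>B. if b = Poly_Mapping.single w 1 then c b else 0)"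
      unfolding lookup_sum
    proof (intro sum.cong refl)
      fix b assume "b \<in> B"
      then obtain u where b: "b = Poly_Mapping.single u 1" using assms(2) by (auto simp: monomials_def)
      have "b = Poly_Mapping.single w 1 \<longleftrightarrow> u = w"
        unfolding b by (metis lookup_single_eq lookup_single_not_eq zero_neq_one)
      thus "Poly_Mapping.lookup (mscale (c b) b) w = (if b = Poly_Mapping.single w 1 then c b else 0)"
        by (auto simp: b lookup_single when_def)
    qed
    thus ?thesis using assms(1) that by simp
  qed
  show ind: "\<not> mpoly.dependent B"
    unfolding mpoly.dependent_finite[OF assms(1)]
  proof safe
    fix c b assume 0: "(\<Sum>b\<in>B. mscale (c b) b) = 0" and b: "b \<in> B" "c b \<noteq> 0"
    then obtain w where "b = Poly_Mapping.single w 1" using assms(2) by (auto simp: monomials_def)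
    thus False using coeff[of w c] 0 b by simp
  qed
  assume "h \<in> mpoly.span B" "Poly_Mapping.single w 1 \<in> B"
  have "(\<Sum>b\<in>B. mscale (mpoly.representation B h b) b) = h"
    by (intro mpoly.sum_representation_eq) (use ind \<open>h \<in> _\<close> assms in auto)
  thus "mpoly.representation B h (Poly_Mapping.single w 1) = Poly_Mapping.lookup h w"
    using coeff[OF \<open>_ \<in> B\<close>, of "mpoly.representation B h"] by simp
qed

lemma ordered_basis_monomial_basis:
  "ordered_basis mscale (R_space d :: ('n::finite, 'a::field) mpoly set) (monomial_basis d)"
proof -
  have inj: "inj (\<lambda>v. Poly_Mapping.single (Abs_poly_mapping v) 1 :: ('n, 'a) mpoly)"
  proof (rule injI)
    fix v w :: "'n \<Rightarrow> nat"
    assume "Poly_Mapping.single (Abs_poly_mapping v) 1 = (Poly_Mapping.single (Abs_poly_mapping w) 1 :: ('n, 'a) mpoly)"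
    hence "Abs_poly_mapping v = Abs_poly_mapping w"
      by (metis lookup_single_eq lookup_single_not_eq zero_neq_one)
    thus "v = w" by (metis lookup_Abs_poly_mapping_finite)
  qed
  have "distinct (monomial_basis d :: ('n, 'a) mpoly list)"
    using inj_on_subset[OF inj subset_UNIV] by (simp add: monomial_basis_def distinct_map enum_set finite_exponent_box)
  moreover have "\<not> mpoly.dependent (R_monomials d :: ('n, 'a) mpoly set)"
    by (intro independent_monomials finite_R_monomials) (auto simp: R_monomials_def)
  ultimately show ?thesis
    by (simp add: ordered_basis_def set_monomial_basis R_space_def)
qed

lemma det_psi_mult:
  fixes f :: "('n::finite, 'a::finite_field) mpoly"
  defines "F \<equiv> f ^ (CARD('a) - 1)" and "d \<equiv> total_degree f"
  shows "det_I_minus mscale (psi_mult f) (R_space d) =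
    det_one_minus_X (mat_on (exponent_box d UNIV) (dwork_entry CARD('a) (exponents F) (coefficient F)))"
proof -
  let ?b = "monomial_basis d :: ('n, 'a) mpoly list"
  have len: "length ?b = card (exponent_box d (UNIV :: 'n set))"
    by (simp add: monomial_basis_def length_enum_set finite_exponent_box)
  have nth: "?b ! i = Poly_Mapping.single (Abs_poly_mapping (enum_set (exponent_box d UNIV) ! i)) 1"
    if "i < card (exponent_box d (UNIV :: 'n set))" for i
    using that by (simp add: monomial_basis_def length_enum_set finite_exponent_box)
  have "op_mat mscale (psi_mult f) ?b = mat_on (exponent_box d UNIV) (dwork_entry CARD('a) (exponents F) (coefficient F))"
  proof (rule eq_matI)
    fix i j
    assume "i < dim_row (mat_on (exponent_box d UNIV) (dwork_entry CARD('a) (exponents F) (coefficient F)))"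
      "j < dim_col (mat_on (exponent_box d UNIV) (dwork_entry CARD('a) (exponents F) (coefficient F)))"
    hence ij: "i < card (exponent_box d (UNIV :: 'n set))" "j < card (exponent_box d (UNIV :: 'n set))"
      by (auto simp: mat_on_def)
    have mem: "?b ! i \<in> R_monomials d" "?b ! j \<in> R_monomials d"
      using ij by (simp_all add: len flip: set_monomial_basis)
    have "psi_mult f (?b ! j) \<in> R_space d"
      using psi_mult_R_space[of f] mem(2) unfolding d_def R_space_def by (blast intro: mpoly.span_base)
    hence "mpoly.representation (R_monomials d) (psi_mult f (?b ! j)) (?b ! i) =
        Poly_Mapping.lookup (psi_mult f (?b ! j)) (Abs_poly_mapping (enum_set (exponent_box d UNIV) ! i))"
      unfolding nth[OF ij(1)] R_space_def
      by (intro independent_monomials finite_R_monomials) (use mem nth[OF ij(1)] in \<open>auto simp: R_monomials_def\<close>)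
    thus "op_mat mscale (psi_mult f) ?b $$ (i, j) =
        mat_on (exponent_box d UNIV) (dwork_entry CARD('a) (exponents F) (coefficient F)) $$ (i, j)"
      using ij by (simp add: op_mat_def mat_on_def len set_monomial_basis nth lookup_psi_mult_monomial F_def)
  qed (simp_all add: op_mat_def mat_on_def len)
  moreover have "det_I_minus mscale (psi_mult f) (R_space d) = Determinant.det (I_minus_T (op_mat mscale (psi_mult f) ?b))"
    using psi_mult_R_space[of f] unfolding d_def
    by (intro det_I_minus_eq linear_psi_mult ordered_basis_monomial_basis mpoly.vector_space_axioms)
  ultimately show ?thesis by (simp add: det_I_minus_T)
qed

section \<open>The congruence\<close>

lemma comm_ring_hom_to_ac: "comm_ring_hom (to_ac :: 'a::field \<Rightarrow> 'a alg_closure)"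
  by standard auto

text \<open>
  For each \<open>m\<close> there is an integer polynomial \<open>U\<close>, namely \<open>det (1 - P T)\<close> for the field with \<open>q^(m!)\<close>
  elements, that links both sides up to \<open>T^m\<close>: rationally it is \<open>Z(X,T) (1 - q^n T)\<close>, and modulo \<open>p\<close> it
  is the determinant on the space of polynomials, or the inverse of that determinant.
\<close>
lemma truncated_congruence:
  fixes f :: "('n::finite, 'a::finite_field) mpoly" and m :: nat
  defines "D \<equiv> det_I_minus mscale (psi_mult f) (R_space (total_degree f))"
  shows "\<exists>U :: int poly. \<forall>j\<le>m.
     fps_nth (zeta f * (1 - fps_const (of_nat (CARD('a) ^ CARD('n))) * fps_X)) j = of_int (coeff U j) \<and>
     coeff (if even CARD('n) then map_poly of_int U else map_poly of_int U * D) j =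
     coeff (if even CARD('n) then D else 1) j"
proof -
  define q where "q = CARD('a)"
  \<comment> \<open>A common multiple of \<open>1, \<dots>, m\<close>, so that one field contains all those whose points matter.\<close>
  define K :: nat where "K = fact m"
  define N where "N = q ^ K - 1"
  define F where "F = f ^ (q - 1)"
  define S where "S = exponents F"
  define d where "d = total_degree f"
  have q: "q \<ge> 2" using card_finite_field_gt_1[where 'a = 'a] by (simp add: q_def)
  have K: "K \<ge> 1" by (simp add: K_def)
  have m: "k dvd K" if "1 \<le> k" "k \<le> m" for k using that by (simp add: K_def dvd_fact)
  obtain g :: "'a alg_closure" where g: "primitive_root N g" and gen: "ext_field K - {0} = (\<lambda>j. g ^ j) ` {..<N}"
    using exists_generator_ext_field[OF K, where 'a = 'a] unfolding N_def q_def by blast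
  have "\<exists>p. int_poly_eval g p = to_ac c" for c :: 'a
  proof (cases "c = 0")
    case True
    thus ?thesis by (intro exI[of _ 0]) simp
  next
    case False
    have "to_ac c \<in> ext_field K" by (rule ext_field_closed(5)[of 0 _ 0]) (simp_all add: ext_field_def)
    hence "to_ac c \<in> (\<lambda>j. g ^ j) ` {..<N}" using False gen by (metis Diff_iff empty_iff insert_iff to_ac_eq_0_iff)
    then obtain j where "to_ac c = g ^ j" by blast
    thus ?thesis by (intro exI[of _ "monom 1 j"]) simp
  qed
  then obtain lift where lift: "\<And>c :: 'a. int_poly_eval g (lift c) = to_ac c" by metis
  let ?c = "\<lambda>e. to_ac (coefficient F e)"
  define U :: "int poly" where "U = det_one_minus_X (complement_mat N g f)"
  have S: "sum e UNIV \<le> d * (q - 1)" if "e \<in> S" for e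
    using that mdegree_keys_power[of _ f "q - 1"] by (auto simp: S_def exponents_def F_def d_def mdegree_def)
  have "of_nat q = (0 :: 'a alg_closure)"
    using finite_field_of_nat_CARD[where 'a = 'a] unfolding q_def by (metis to_ac_0 to_ac_of_nat)
  note id = det_identity_mod_p[OF g N_def K q m S _ this, where c = "\<lambda>e. lift (coefficient F e)"
      and S = S and m = m, unfolded lift]
  have W: "teich_weight N g S ?c x = mpoly_eval f (\<lambda>i. teich N g (x i)) ^ (q - 1)" for x
  proof -
    have "teich_weight N g S ?c x = mpoly_eval F (\<lambda>i. teich N g (x i))"
      unfolding teich_weight_def S_def mpoly_eval_def
      by (rule sum_exponents[where F = "\<lambda>c e. to_ac c * (\<Prod>i\<in>UNIV. teich N g (x i) ^ e i)"])
    thus ?thesis by (simp add: F_def mpoly_eval_power)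
  qed
  have "det_one_minus_X (teich_mat N q g S ?c) = det_one_minus_X (complement_mat N g f :: 'a alg_closure mat)"
    unfolding teich_mat_def complement_mat_def q_def[symmetric]
  \<comment> \<open>The diagonal entries are the values of \<open>f\<close>, replaced by \<open>1\<close> at the zeros of \<open>f\<close>, where both weights vanish.\<close>
  proof (rule det_weighted_map_coboundary[OF finite_teich_points, where
        \<delta> = "\<lambda>x. if mpoly_eval f (\<lambda>i. teich N g (x i)) = 0 then 1 else mpoly_eval f (\<lambda>i. teich N g (x i))"])
    fix x :: "'n \<Rightarrow> nat"
    have "mpoly_eval f (\<lambda>i. teich N g ((frob N q \<circ> x) i)) = mpoly_eval f (\<lambda>i. teich N g (x i)) ^ q"
      using mpoly_eval_teich_frob[OF g, of f 1 x] by (simp add: q_def)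
    moreover have "y ^ (q - 1) * y = y ^ q" for y :: "'a alg_closure"
      using q by (cases q) (simp_all add: mult.commute)
    ultimately show "teich_weight N g S ?c x * (if mpoly_eval f (\<lambda>i. teich N g (x i)) = 0 then 1 else mpoly_eval f (\<lambda>i. teich N g (x i))) =
      (if mpoly_eval f (\<lambda>i. teich N g ((frob N q \<circ> x) i)) = 0 then 1 else mpoly_eval f (\<lambda>i. teich N g ((frob N q \<circ> x) i))) *
      of_bool (mpoly_eval f (\<lambda>i. teich N g (x i)) \<noteq> 0)"
      using q by (auto simp: W zero_power)
  qed auto
  also have "\<dots> = map_poly of_int U"
    unfolding U_def by (rule det_complement_mat) (rule of_int_hom.comm_ring_hom_axioms)
  also have "\<dots> = map_poly to_ac (map_poly of_int U)"
    by (rule poly_eqI) (simp add: coeff_map_poly)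
  finally have T: "det_one_minus_X (teich_mat N q g S ?c) = map_poly to_ac (map_poly of_int U)" .
  have D: "det_one_minus_X (mat_on (exponent_box d UNIV) (dwork_entry q S ?c)) = map_poly to_ac D"
  proof -
    have "map_mat to_ac (mat_on (exponent_box d UNIV) (dwork_entry q S (coefficient F))) = mat_on (exponent_box d UNIV) (dwork_entry q S ?c)"
      by (simp add: map_mat_mat_on dwork_entry_def[abs_def] to_ac_sum of_bool_def if_distrib[of to_ac] cong: if_cong)
    thus ?thesis
      using det_one_minus_X_hom[OF comm_ring_hom_to_ac mat_on_carrier, of "exponent_box d UNIV" "dwork_entry q S (coefficient F)"]
      by (simp add: D_def det_psi_mult d_def F_def S_def q_def)
  qed
  interpret to_ac: map_poly_comm_ring_hom "to_ac :: 'a \<Rightarrow> 'a alg_closure"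
    by (rule map_poly_comm_ring_hom.intro) (rule comm_ring_hom_to_ac)
  show ?thesis
  proof (intro exI[of _ U] allI impI conjI)
    fix j assume j: "j \<le> m"
    show "fps_nth (zeta f * (1 - fps_const (of_nat (CARD('a) ^ CARD('n))) * fps_X)) j = of_int (coeff U j)"
      unfolding U_def by (rule zeta_eq_det_complement[OF K _ g gen m j]) (simp add: N_def q_def)
    have lhs: "(if even CARD('n) then map_poly to_ac (map_poly of_int U) else map_poly to_ac (map_poly of_int U) * map_poly to_ac D)
       = map_poly to_ac (if even CARD('n) then map_poly of_int U else map_poly of_int U * D)"
      by (simp only: if_distrib[of "map_poly to_ac"] to_ac.hom_mult)
    have rhs: "(if even CARD('n) then map_poly to_ac D else 1) = map_poly to_ac (if even CARD('n) then D else 1)"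
      by (simp only: if_distrib[of "map_poly to_ac"] to_ac.hom_one)
    have "coeff (map_poly to_ac (if even CARD('n) then map_poly of_int U else map_poly of_int U * D)) j =
       coeff (map_poly to_ac (if even CARD('n) then D else 1)) j"
      using id[OF _ _ _ j] unfolding T D lhs rhs by blast
    thus "coeff (if even CARD('n) then map_poly of_int U else map_poly of_int U * D) j =
       coeff (if even CARD('n) then D else 1) j"
      by (simp only: coeff_map_poly[of to_ac, OF to_ac_0] to_ac_eq_iff)
  qed
qed

definition fps_of_int :: "int fps \<Rightarrow> 'a::comm_ring_1 fps" where
  "fps_of_int A = Abs_fps (\<lambda>k. of_int (fps_nth A k))"

lemma fps_of_int_mult: "fps_of_int (A * B) = fps_of_int A * fps_of_int B"
  by (rule fps_ext) (simp add: fps_of_int_def fps_mult_nth)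

lemma fps_of_int_1: "fps_of_int 1 = 1"
  by (rule fps_ext) (simp add: fps_of_int_def)

lemma left_inverse_eq_right_inverse:
  fixes a b c :: "'a::monoid_mult"
  assumes "a * b = 1" "b * c = 1"
  shows "a = c"
proof -
  have "a = a * (b * c)" using assms(2) by simp
  also have "\<dots> = c" using assms(1) by (simp flip: mult.assoc)
  finally show ?thesis .
qed

theorem theorem4p2:
  fixes f :: "('n::finite, 'a::finite_field) mpoly" and d :: nat
  assumes "total_degree f = d"
  shows "psi_mult f ` R_space d \<subseteq> R_space d \<and>
         reduces_mod_p (zeta f powi ((-1) ^ CARD('n)))
           (fps_of_poly (det_I_minus mscale (psi_mult f) (R_space d)))"
proof
  show "psi_mult f ` R_space d \<subseteq> R_space d"
    using psi_mult_R_space[of f] assms by simp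
  define D where "D = det_I_minus mscale (psi_mult f) (R_space d)"
  define Q where "Q = CARD('a) ^ CARD('n)"
  have "\<forall>m. \<exists>U :: int poly. \<forall>j\<le>m.
     fps_nth (zeta f * (1 - fps_const (of_nat Q) * fps_X)) j = of_int (coeff U j) \<and>
     coeff (if even CARD('n) then map_poly of_int U else map_poly of_int U * D) j =
     coeff (if even CARD('n) then D else 1) j"
    using truncated_congruence[where f = f] unfolding assms Q_def D_def by blast
  then obtain U :: "nat \<Rightarrow> int poly" where
    U: "\<And>m j. j \<le> m \<Longrightarrow> fps_nth (zeta f * (1 - fps_const (of_nat Q) * fps_X)) j = of_int (coeff (U m) j)"
    and UD: "\<And>m j. j \<le> m \<Longrightarrow> coeff (if even CARD('n) then map_poly of_int (U m) else map_poly of_int (U m) * D) j =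
        coeff (if even CARD('n) then D else 1) j"
    by metis
  \<comment> \<open>The polynomials \<open>U m\<close> depend on \<open>m\<close>, but their coefficients up to \<open>m\<close> are those of one series, which is
    \<open>Z(X,T) (1 - q^n T)\<close>. The series \<open>E\<close> is the inverse of \<open>1 - q^n T\<close>, and reduces to \<open>1\<close>.\<close>
  define A where "A = Abs_fps (\<lambda>j. coeff (U j) j)"
  define E where "E = Abs_fps (\<lambda>k. int Q ^ k)"
  have A: "fps_nth A j = coeff (U m) j" if "j \<le> m" for j m
    using U[of j j] U[OF that] by (simp add: A_def)
  have zeta_A: "zeta f * (1 - fps_const (of_nat Q) * fps_X) = fps_of_int A"
    by (rule fps_ext) (simp add: fps_of_int_def A_def U[OF order_refl])
  have "(1 - fps_const (of_nat Q) * fps_X) * fps_of_int E = (1 :: rat fps)"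
  proof (rule fps_ext)
    fix j show "fps_nth ((1 - fps_const (of_nat Q) * fps_X) * fps_of_int E) j = fps_nth (1 :: rat fps) j"
      by (cases j) (simp_all add: left_diff_distrib mult.assoc fps_of_int_def E_def)
  qed
  hence zeta: "zeta f = fps_of_int (A * E)"
    unfolding fps_of_int_mult zeta_A[symmetric] mult.assoc by simp
  have "of_nat Q = (0 :: 'a)"
    by (simp add: Q_def finite_field_of_nat_CARD)
  hence "fps_of_int E = (1 :: 'a fps)"
    by (intro fps_ext) (simp add: fps_of_int_def E_def power_0_left)
  hence AE: "fps_of_int (A * E) = (fps_of_int A :: 'a fps)"
    by (simp add: fps_of_int_mult)
  show "reduces_mod_p (zeta f powi ((-1) ^ CARD('n))) (fps_of_poly D)"
    unfolding reduces_mod_p_def fps_of_int_def[symmetric]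
  proof (cases "even CARD('n)")
    case True
    have "fps_of_int A = fps_of_poly D"
      using UD[OF order_refl] True by (intro fps_ext) (simp add: fps_of_int_def A_def coeff_map_poly)
    thus "\<exists>B. zeta f powi ((-1) ^ CARD('n)) = fps_of_int B \<and> fps_of_poly D = fps_of_int B"
      using True zeta AE by (intro exI[of _ "A * E"]) simp
  next
    case False
    have AD: "fps_of_int A * fps_of_poly D = 1"
    proof (rule fps_ext)
      fix j
      have "fps_nth (fps_of_int A * fps_of_poly D) j = coeff (map_poly of_int (U j) * D) j"
        unfolding fps_mult_nth coeff_mult atLeast0AtMost
        by (intro sum.cong refl) (simp add: fps_of_int_def A[of _ j] coeff_map_poly)
      also have "\<dots> = coeff 1 j" using UD[of j j] False by simp
      finally show "fps_nth (fps_of_int A * fps_of_poly D) j = fps_nth 1 j" by simp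
    qed
    have "fps_nth (zeta f) 0 = 1" using log_derivative_zeta[of f] by (simp add: log_derivative_def)
    hence "rat_of_int (fps_nth (A * E) 0) = 1" unfolding zeta fps_of_int_def fps_nth_Abs_fps .
    hence "fps_nth (A * E) 0 = 1" by (simp only: of_int_eq_1_iff)
    hence "A * E * fps_right_inverse (A * E) 1 = 1" by (intro fps_right_inverse) simp
    then obtain B where B: "A * E * B = 1" by blast
    have zB: "zeta f * fps_of_int B = 1"
      unfolding zeta fps_of_int_mult[symmetric] B by (rule fps_of_int_1)
    have "inverse (zeta f) * zeta f = 1"
      using \<open>fps_nth (zeta f) 0 = 1\<close> by (intro inverse_mult_eq_1) simp
    hence "inverse (zeta f) = fps_of_int B"
      using zB by (rule left_inverse_eq_right_inverse)
    hence 1: "zeta f powi ((-1) ^ CARD('n)) = fps_of_int B"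
      using False by (simp add: power_int_minus)
    have AB: "fps_of_int A * fps_of_int B = (1 :: 'a fps)"
      unfolding AE[symmetric] fps_of_int_mult[symmetric] B by (rule fps_of_int_1)
    have "fps_of_poly D * fps_of_int A = 1"
      using AD by (simp only: mult.commute)
    hence "fps_of_poly D = fps_of_int B"
      using AB by (rule left_inverse_eq_right_inverse)
    with 1 show "\<exists>B. zeta f powi ((-1) ^ CARD('n)) = fps_of_int B \<and> fps_of_poly D = fps_of_int B" by blast
  qed
qed

end
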